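(* The product set $F_4^*\cdot F_4^*=\{xy : x,y\in F_4^*\}$ is a closed interval, namely $$F_4^*\cdot F_4^*=\Bigl[[4;3,\overline{1,4,1,4,1,3}]^2,\ [4;3,\overline{4,1,4,1,3,1}]^2\Bigr]=\left[\frac{106609+261\sqrt{26565}}{8214},\ \frac{15143783-5501\sqrt{26565}}{766322}\right].$$
   Context: $F_4^*$ is the set of all irrational numbers $x=[x_0;x_1,x_2,\dots]$ (infinite regular continued fractions) such that $(x_0,x_1)=(4,3)$ and, for all $i\ge 0$: $x_i\in\{1,2,3,4\}$; $(x_i,x_{i+1})\ne(4,4)$; and $(x_i,x_{i+1},x_{i+2},x_{i+3},x_{i+4})\ne(4,1,4,1,4)$. An overline denotes a periodically repeated block of partial quotients. *)

theory Defs
  imports Complex_Main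
begin

(* cfrac_convergent a n is the finite continued fraction [a 0; a 1, ..., a n]. *)
fun cfrac_convergent :: "(nat \<Rightarrow> int) \<Rightarrow> nat \<Rightarrow> real" where
  "cfrac_convergent a 0 = of_int (a 0)"
| "cfrac_convergent a (Suc n) = of_int (a 0) + 1 / cfrac_convergent (\<lambda>i. a (Suc i)) n"

definition has_cfrac :: "real \<Rightarrow> (nat \<Rightarrow> int) \<Rightarrow> bool" where
  "has_cfrac x a \<longleftrightarrow> (\<forall>i\<ge>1. a i \<ge> 1) \<and> cfrac_convergent a \<longlonglongrightarrow> x"

(* For positive a 1, a 2, ... the convergents converge, so the description is proper. *)
definition cfrac :: "(nat \<Rightarrow> int) \<Rightarrow> real" where
  "cfrac a = (THE x. has_cfrac x a)"

(* Partial quotients us followed by the block vs repeated forever; vs must be nonempty. *)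
definition periodic_seq :: "int list \<Rightarrow> int list \<Rightarrow> nat \<Rightarrow> int" where
  "periodic_seq us vs n =
     (if n < length us then us ! n else vs ! ((n - length us) mod length vs))"

definition F4_star :: "real set" where
  "F4_star = {x. x \<notin> \<rat> \<and> (\<exists>a. has_cfrac x a \<and>
     (a 0, a 1) = (4, 3) \<and>
     (\<forall>i. a i \<in> {1, 2, 3, 4} \<and>
          (a i, a (i+1)) \<noteq> (4, 4) \<and>
          (a i, a (i+1), a (i+2), a (i+3), a (i+4)) \<noteq> (4, 1, 4, 1, 4)))}"

end

(* The set F4_star is a Cantor set generated by a tree of intervals: every interval is a hull of the
   numbers whose expansion starts with a fixed word, followed by a digit \<ge> k, and removing the gap
   between the digits k and k + 1 splits it in two.  Measured multiplicatively (by the ratio of the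
   endpoints), every gap is at most as large as either of the two bridges next to it, and gaps shrink
   along the tree.  As in the proofs of Hall and Newhouse, if the product of two intervals is an
   interval and each is at least as large as the gap of the other, then one of the halves of the
   interval with the larger gap can replace it without losing a given point of the product.
   Iterating, every point of the product of the hulls is a product of two limit points.
   Everything reduces to finitely many numerical inequalities because the forbidden blocks are
   recognised by an automaton with five states. *)
theory Submission
  imports Defs
begin

section \<open>Products of interval trees with small gaps\<close>

text \<open>Halving an interval can be repeated only if it keeps the mutual comparison intact. The
  bridges are compared with the gap of the same interval, so a half dominates the other interval's
  gap only when the larger gap is removed. The other interval in turn is only known to dominate the
  removed gap, so the gap of the surviving half must not exceed it. This is why monotonicity of the
  gaps stands beside the two bridge inequalities. For continued fractions the difficulty is
  uniformity over infinitely many words. Ratios help: for a Moebius map of determinant 1, the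
  relative length of the image of an interval is the original length divided by a product of two
  linear forms. A word enters a comparison of two such lengths only through the quotients of the
  coefficients of these forms, and the automaton state bounds those quotients from below.\<close>

locale ratio_tree =
  fixes V :: "'v set" and l g1 g2 u :: "'v \<Rightarrow> real" and lc rc :: "'v \<Rightarrow> 'v" and m :: "'v \<Rightarrow> nat"
  assumes lc_in: "v \<in> V \<Longrightarrow> lc v \<in> V" and rc_in: "v \<in> V \<Longrightarrow> rc v \<in> V"
    and pos: "v \<in> V \<Longrightarrow> 0 < l v"
    and ordered: "v \<in> V \<Longrightarrow> l v \<le> g1 v" "v \<in> V \<Longrightarrow> g1 v \<le> g2 v" "v \<in> V \<Longrightarrow> g2 v \<le> u v"
    and lc_ends: "v \<in> V \<Longrightarrow> l (lc v) = l v" "v \<in> V \<Longrightarrow> u (lc v) = g1 v"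
    and rc_ends: "v \<in> V \<Longrightarrow> l (rc v) = g2 v" "v \<in> V \<Longrightarrow> u (rc v) = u v"
    and left_bridge: "v \<in> V \<Longrightarrow> g2 v / g1 v \<le> g1 v / l v"
    and right_bridge: "v \<in> V \<Longrightarrow> g2 v / g1 v \<le> u v / g2 v"
    and lc_gap: "v \<in> V \<Longrightarrow> g2 (lc v) / g1 (lc v) \<le> g2 v / g1 v"
    and rc_gap: "v \<in> V \<Longrightarrow> g2 (rc v) / g1 (rc v) \<le> g2 v / g1 v"
    and m_lc: "v \<in> V \<Longrightarrow> m v < m (lc v)" and m_rc: "v \<in> V \<Longrightarrow> m v < m (rc v)"
    and gap_lower: "\<exists>e>1. \<forall>v\<in>V. m v \<le> N \<longrightarrow> e \<le> g2 v / g1 v"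
    and gap_upper: "e > 1 \<Longrightarrow> \<exists>M. \<forall>v\<in>V. M \<le> m v \<longrightarrow> g2 v / g1 v < e"
begin

definition linked :: "'v \<Rightarrow> 'v \<Rightarrow> bool" where
  "linked v w \<longleftrightarrow> v \<in> V \<and> w \<in> V \<and> g2 v / g1 v \<le> u w / l w \<and> g2 w / g1 w \<le> u v / l v"

definition desc :: "'v \<Rightarrow> 'v \<Rightarrow> bool" where
  "desc = (\<lambda>v v'. v \<in> V \<and> (v' = lc v \<or> v' = rc v))\<^sup>*\<^sup>*"

lemma linked_sym: "linked v w \<longleftrightarrow> linked w v"
  by (auto simp: linked_def)

lemma desc_refl [simp]: "desc v v"
  by (simp add: desc_def)

lemma desc_trans [trans]: "desc v v' \<Longrightarrow> desc v' v'' \<Longrightarrow> desc v v''"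
  unfolding desc_def by (rule rtranclp_trans)

lemma desc_child: "v \<in> V \<Longrightarrow> v' \<in> {lc v, rc v} \<Longrightarrow> desc v v'"
  unfolding desc_def by auto

text \<open>Both bridges of \<open>v\<close> are at least its gap, hence by \<open>le\<close> at
  least the gap of \<open>w\<close>, so either half stays linked. The gap of \<open>v\<close> is at
  most \<open>u w / l w\<close>, so the two half products overlap and one of them contains
  \<open>z\<close>.\<close>

lemma split_linked:
  assumes "linked v w" and le: "g2 w / g1 w \<le> g2 v / g1 v" and z: "z \<in> {l v * l w..u v * u w}"
  obtains v' where "v' \<in> {lc v, rc v}" "linked v' w" "z \<in> {l v' * l w..u v' * u w}"
proof -
  have v: "v \<in> V" and w: "w \<in> V" and vw: "g2 v / g1 v \<le> u w / l w"
    using assms(1) by (auto simp: linked_def)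
  have p: "0 < l v" "0 < l w" "0 < g1 v"
    using pos[OF v] pos[OF w] ordered[OF v] by auto
  have L1: "linked (lc v) w"
    using v w vw le lc_in[OF v] lc_ends[OF v] lc_gap[OF v] left_bridge[OF v]
    unfolding linked_def by auto
  have L2: "linked (rc v) w"
    using v w vw le rc_in[OF v] rc_ends[OF v] rc_gap[OF v] right_bridge[OF v]
    unfolding linked_def by auto
  have overlap: "g2 v * l w \<le> g1 v * u w"
    using vw p by (simp add: field_simps)
  show ?thesis
  proof (cases "z \<le> g1 v * u w")
    case True
    then show ?thesis using that[of "lc v"] L1 z lc_ends[OF v] by auto
  next
    case False
    then show ?thesis using that[of "rc v"] L2 z rc_ends[OF v] overlap by auto
  qed
qed

text \<open>Always splitting the larger gap might seem to leave one interval shallow forever. But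
  while one depth is below \<open>N\<close>, the larger gap is at least \<open>e\<close>, and
  \<open>high\<close> then puts its node at depth below \<open>M\<close>. So every split uses up
  some of the depth remaining up to \<open>M\<close>.\<close>

lemma refine_linked:
  assumes "linked v w" and "z \<in> {l v * l w..u v * u w}"
  shows "\<exists>v' w'. linked v' w' \<and> z \<in> {l v' * l w'..u v' * u w'} \<and> desc v v' \<and> desc w w'
           \<and> N \<le> m v' \<and> N \<le> m w'"
proof -
  obtain e where e: "e > 1" and low: "\<And>v. v \<in> V \<Longrightarrow> m v \<le> N \<Longrightarrow> e \<le> g2 v / g1 v"
    using gap_lower[of N] by blast
  obtain M where high: "\<And>v. v \<in> V \<Longrightarrow> M \<le> m v \<Longrightarrow> g2 v / g1 v < e"
    using gap_upper[OF e] by blast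
  from assms show ?thesis
  proof (induction "(M - m v) + (M - m w)" arbitrary: v w rule: less_induct)
    case less
    have V: "v \<in> V" "w \<in> V" using less.prems(1) by (auto simp: linked_def)
    show ?case
    proof (cases "N \<le> m v \<and> N \<le> m w")
      case True
      then show ?thesis using less.prems desc_refl by blast
    next
      case False
      then have big: "e \<le> g2 v / g1 v \<or> e \<le> g2 w / g1 w" using low V by force
      show ?thesis
      proof (cases "g2 w / g1 w \<le> g2 v / g1 v")
        case True
        then obtain v' where v': "v' \<in> {lc v, rc v}" "linked v' w" "z \<in> {l v' * l w..u v' * u w}"
          using split_linked less.prems by blast
        have "m v < M" using big True high[OF V(1)] by force
        moreover have "m v < m v'" using v'(1) m_lc[OF V(1)] m_rc[OF V(1)] by auto
        ultimately have "(M - m v') + (M - m w) < (M - m v) + (M - m w)" by linarith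
        from less.hyps[OF this v'(2,3)] show ?thesis
          using desc_child[OF V(1) v'(1)] desc_trans by meson
      next
        case False
        then have "g2 v / g1 v \<le> g2 w / g1 w" by simp
        then obtain w' where w': "w' \<in> {lc w, rc w}" "linked w' v" "z \<in> {l w' * l v..u w' * u v}"
          using split_linked[of w v z] less.prems linked_sym by (metis mult.commute)
        have "m w < M" using big False high[OF V(2)] by force
        moreover have "m w < m w'" using w'(1) m_lc[OF V(2)] m_rc[OF V(2)] by auto
        ultimately have "(M - m v) + (M - m w') < (M - m v) + (M - m w)" by linarith
        moreover have "linked v w'" "z \<in> {l v * l w'..u v * u w'}"
          using w'(2,3) linked_sym by (simp_all add: mult.commute)
        ultimately show ?thesis
          using less.hyps[of v w'] desc_child[OF V(2) w'(1)] desc_trans by meson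
      qed
    qed
  qed
qed

lemma linked_branches:
  assumes "linked v w" and "z \<in> {l v * l w..u v * u w}"
  obtains f g :: "nat \<Rightarrow> 'v" where "\<And>n. desc v (f n)" "\<And>n. desc (f n) (f (Suc n))" "\<And>n. n \<le> m (f n)"
    "\<And>n. desc w (g n)" "\<And>n. desc (g n) (g (Suc n))" "\<And>n. n \<le> m (g n)"
    "\<And>n. f n \<in> V" "\<And>n. g n \<in> V" "\<And>n. z \<in> {l (f n) * l (g n)..u (f n) * u (g n)}"
proof -
  define P where "P n x \<longleftrightarrow> (case x of (v', w') \<Rightarrow> linked v' w' \<and> z \<in> {l v' * l w'..u v' * u w'}
      \<and> desc v v' \<and> desc w w' \<and> n \<le> m v' \<and> n \<le> m w')" for n x
  have "\<exists>h. \<forall>n. P n (h n) \<and> desc (fst (h n)) (fst (h (Suc n))) \<and> desc (snd (h n)) (snd (h (Suc n)))"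
  proof (rule dependent_nat_choice)
    have "P 0 (v, w)" using assms by (simp add: P_def)
    then show "\<exists>x. P 0 x" ..
  next
    fix x n assume "P n x"
    then obtain v1 w1 where x: "x = (v1, w1)" and 1: "linked v1 w1" "z \<in> {l v1 * l w1..u v1 * u w1}"
      and d: "desc v v1" "desc w w1" by (cases x) (auto simp: P_def)
    obtain v2 w2 where 2: "linked v2 w2" "z \<in> {l v2 * l w2..u v2 * u w2}" "desc v1 v2" "desc w1 w2"
      "Suc n \<le> m v2" "Suc n \<le> m w2" using refine_linked[OF 1] by blast
    have "P (Suc n) (v2, w2)" using 2 d desc_trans unfolding P_def by blast
    then show "\<exists>y. P (Suc n) y \<and> desc (fst x) (fst y) \<and> desc (snd x) (snd y)"
      using x 2(3,4) by (intro exI[of _ "(v2, w2)"]) simp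
  qed
  then obtain h where h: "\<And>n. P n (h n)"
    "\<And>n. desc (fst (h n)) (fst (h (Suc n)))" "\<And>n. desc (snd (h n)) (snd (h (Suc n)))" by blast
  have "linked (fst (h n)) (snd (h n)) \<and> z \<in> {l (fst (h n)) * l (snd (h n))..u (fst (h n)) * u (snd (h n))}
      \<and> desc v (fst (h n)) \<and> desc w (snd (h n)) \<and> n \<le> m (fst (h n)) \<and> n \<le> m (snd (h n))" for n
    using h(1)[of n] unfolding P_def case_prod_beta .
  with h(2,3) show ?thesis
    by (intro that[of "\<lambda>n. fst (h n)" "\<lambda>n. snd (h n)"]) (auto simp: linked_def)
qed

end

section \<open>Continued fractions with digits at most four\<close>

definition digit_seq :: "(nat \<Rightarrow> int) \<Rightarrow> bool" where
  "digit_seq a \<longleftrightarrow> (\<forall>i. 1 \<le> a i \<and> a i \<le> 4)"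

lemma digit_seq_shift: "digit_seq a \<Longrightarrow> digit_seq (\<lambda>i. a (Suc i))"
  by (simp add: digit_seq_def)

lemma digit_seq_bounds: "digit_seq a \<Longrightarrow> 1 \<le> real_of_int (a i)" "digit_seq a \<Longrightarrow> real_of_int (a i) \<le> 4"
  by (auto simp: digit_seq_def of_int_le_iff[of _ 4, simplified])

section \<open>Geometric convergence, limits and irrationality\<close>

lemma convergent_bounds:
  "digit_seq a \<Longrightarrow> 1 \<le> cfrac_convergent a n \<and> cfrac_convergent a n \<le> 5"
proof (induction n arbitrary: a)
  case 0
  then show ?case using digit_seq_bounds[of a 0] by simp
next
  case (Suc n)
  from Suc.IH[OF digit_seq_shift[OF Suc.prems]] digit_seq_bounds[OF Suc.prems, of 0]
  have "0 \<le> 1 / cfrac_convergent (\<lambda>i. a (Suc i)) n" "1 / cfrac_convergent (\<lambda>i. a (Suc i)) n \<le> 1"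
    by auto
  then show ?case using digit_seq_bounds[OF Suc.prems, of 0] unfolding cfrac_convergent.simps by linarith
qed

lemma convergent_Suc_lower:
  assumes "digit_seq a"
  shows "6/5 \<le> cfrac_convergent a (Suc n)"
proof -
  have "1/5 \<le> 1 / cfrac_convergent (\<lambda>i. a (Suc i)) n"
    using convergent_bounds[OF digit_seq_shift[OF assms], of n] by (intro divide_left_mono) auto
  then show ?thesis using digit_seq_bounds[OF assms, of 0] by simp
qed

text \<open>The hypotheses are asymmetric because a zeroth convergent can equal 1, whereas later
  convergents and limits are at least 1 + 1/5.\<close>

lemma inverse_diff_le:
  assumes "1 \<le> x" "6/5 \<le> (y::real)"
  shows "\<bar>1 / x - 1 / y\<bar> \<le> 5/6 * \<bar>x - y\<bar>"
proof -
  have "1 / x - 1 / y = (y - x) / (x * y)" using assms by (simp add: field_simps)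
  then have "\<bar>1 / x - 1 / y\<bar> = \<bar>x - y\<bar> / (x * y)"
    using assms by (simp add: abs_mult abs_minus_commute)
  also have "\<dots> \<le> \<bar>x - y\<bar> / (1 * (6/5))"
    using assms by (intro divide_left_mono mult_mono) auto
  finally show ?thesis by simp
qed

lemma convergent_diff_le:
  "digit_seq a \<Longrightarrow> n \<le> k \<Longrightarrow> \<bar>cfrac_convergent a n - cfrac_convergent a k\<bar> \<le> 4 * (5/6) ^ n"
proof (induction n arbitrary: a k)
  case 0
  then show ?case using convergent_bounds[of a 0] convergent_bounds[of a k] by auto
next
  case (Suc n)
  then obtain j where j: "k = Suc j" "n \<le> j" by (cases k) auto
  let ?b = "\<lambda>i. a (Suc i)"
  have b: "digit_seq ?b" using Suc.prems digit_seq_shift by blast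
  have "\<bar>1 / cfrac_convergent ?b n - 1 / cfrac_convergent ?b j\<bar>
      \<le> 5/6 * \<bar>cfrac_convergent ?b n - cfrac_convergent ?b j\<bar>"
  \<comment> \<open>Only a positive index gives the bound \<open>6/5\<close>; \<open>j = 0\<close>
    forces \<open>n = 0\<close>, where both sides vanish.\<close>
  proof (cases j)
    case 0
    then show ?thesis using j by simp
  next
    case (Suc i)
    then show ?thesis
      using convergent_bounds[OF b, of n] convergent_Suc_lower[OF b, of i]
      by (intro inverse_diff_le) auto
  qed
  also have "\<dots> \<le> 5/6 * (4 * (5/6) ^ n)"
    using Suc.IH[OF b j(2)] by simp
  finally show ?case using j by simp
qed

lemma convergent_converges:
  assumes "digit_seq a"
  shows "convergent (cfrac_convergent a)"
proof (rule Cauchy_convergent, rule metric_CauchyI)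
  fix e :: real assume "e > 0"
  have "(\<lambda>n. 4 * (5/6::real) ^ n) \<longlonglongrightarrow> 4 * 0"
    by (intro tendsto_intros LIMSEQ_power_zero) simp
  from order_tendstoD(2)[OF this, of "e/2"]
  have "eventually (\<lambda>n. 4 * (5/6::real) ^ n < e/2) sequentially"
    using \<open>e > 0\<close> by simp
  then obtain N where N: "4 * (5/6::real) ^ N < e/2" by (auto simp: eventually_sequentially)
  show "\<exists>M. \<forall>m\<ge>M. \<forall>n\<ge>M. dist (cfrac_convergent a m) (cfrac_convergent a n) < e"
  proof (intro exI[of _ N] allI impI)
    fix m n assume "N \<le> m" "N \<le> n"
    with convergent_diff_le[OF assms, of N m] convergent_diff_le[OF assms, of N n] N
    show "dist (cfrac_convergent a m) (cfrac_convergent a n) < e" by (simp add: dist_real_def)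
  qed
qed

definition cfval :: "(nat \<Rightarrow> int) \<Rightarrow> real" where
  "cfval a = lim (cfrac_convergent a)"

lemma cfval_tendsto: "digit_seq a \<Longrightarrow> cfrac_convergent a \<longlonglongrightarrow> cfval a"
  using convergent_converges by (simp add: cfval_def convergent_LIMSEQ_iff)

lemma has_cfrac_iff: "digit_seq a \<Longrightarrow> has_cfrac x a \<longleftrightarrow> x = cfval a"
  using cfval_tendsto[of a] LIMSEQ_unique[of "cfrac_convergent a"]
  by (auto simp: has_cfrac_def digit_seq_def)

lemma cfrac_eq_cfval: "digit_seq a \<Longrightarrow> cfrac a = cfval a"
  by (simp add: cfrac_def has_cfrac_iff)

lemma cfval_bounds:
  assumes "digit_seq a"
  shows "6/5 \<le> cfval a" "cfval a \<le> 5"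
proof -
  show "6/5 \<le> cfval a"
    using convergent_Suc_lower[OF assms]
    by (intro LIMSEQ_le_const[OF LIMSEQ_Suc[OF cfval_tendsto[OF assms]]]) auto
  show "cfval a \<le> 5"
    using convergent_bounds[OF assms] by (intro LIMSEQ_le_const2[OF cfval_tendsto[OF assms]]) auto
qed

lemma cfval_shift:
  assumes "digit_seq a"
  shows "cfval a = of_int (a 0) + 1 / cfval (\<lambda>i. a (Suc i))"
proof (rule LIMSEQ_unique[OF LIMSEQ_Suc[OF cfval_tendsto[OF assms]]])
  have b: "digit_seq (\<lambda>i. a (Suc i))" using assms digit_seq_shift by blast
  show "(\<lambda>n. cfrac_convergent a (Suc n)) \<longlonglongrightarrow> of_int (a 0) + 1 / cfval (\<lambda>i. a (Suc i))"
    using cfval_bounds(1)[OF b] by (auto intro!: tendsto_intros cfval_tendsto[OF b])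
qed

text \<open>Euclid's algorithm as a descent: if the value is \<open>p / n\<close>, its tail is
  \<open>n / r\<close> with \<open>r = p - a 0 * n\<close>, and \<open>0 < r < n\<close> because the
  tail exceeds 1.\<close>

lemma cfval_neq_fraction:
  "digit_seq a \<Longrightarrow> cfval a \<noteq> of_int p / of_nat n"
proof (induction n arbitrary: a p rule: less_induct)
  case (less n)
  let ?t = "cfval (\<lambda>i. a (Suc i))"
  have b: "digit_seq (\<lambda>i. a (Suc i))" using less.prems digit_seq_shift by blast
  have t: "6/5 \<le> ?t" using cfval_bounds(1)[OF b] .
  show ?case
  proof
    assume eq: "cfval a = of_int p / of_nat n"
    \<comment> \<open>For \<open>n = 0\<close> the quotient is 0 by convention, which is below
      \<open>6/5\<close>.\<close>
    have n: "n > 0" using cfval_bounds(1)[OF less.prems] eq by (cases n) auto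
    define r where "r = p - a 0 * int n"
    have "of_int p / of_nat n = of_int (a 0) + 1 / ?t" using eq cfval_shift[OF less.prems] by simp
    then have r: "of_int r = of_nat n / ?t"
      using n t by (simp add: r_def field_simps)
    have "0 < of_nat n / ?t" "of_nat n / ?t < of_nat n" using n t by (auto simp: field_simps)
    then have "0 < r" "r < int n" using r by (metis of_int_0_less_iff, metis of_int_less_iff of_int_of_nat_eq)
    moreover have "?t = of_int (int n) / of_nat (nat r)"
      using r n t \<open>0 < r\<close> by (simp add: field_simps)
    ultimately show False using less.IH[of "nat r" "\<lambda>i. a (Suc i)" "int n"] b by linarith
  qed
qed

lemma cfval_irrational: "digit_seq a \<Longrightarrow> cfval a \<notin> \<rat>"
  by (metis Rats_cases' cfval_neq_fraction zero_less_imp_eq_int of_int_of_nat_eq)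

section \<open>The automaton of forbidden blocks and the extreme tails\<close>

text \<open>A state is the longest suffix of the digits read so far that is a proper prefix of the
  forbidden block \<open>4, 1, 4, 1, 4\<close>.\<close>

datatype state = S0 | S4 | S41 | S414 | S4141

definition nxt :: "state \<Rightarrow> int \<Rightarrow> state" where
  "nxt s d = (if d = 4 then if s = S41 then S414 else S4
              else if d = 1 then if s = S4 then S41 else if s = S414 then S4141 else S0
              else S0)"

text \<open>Both forbidden blocks end in 4, so 4 is the only digit that can ever be excluded: after
  a 4 (\<open>S4\<close>, \<open>S414\<close>) by the block 4, 4, and in \<open>S4141\<close> by the
  long block. Admissibility thus becomes an upper bound on each digit.\<close>

definition max_digit :: "state \<Rightarrow> int" where
  "max_digit s = (if s = S0 \<or> s = S41 then 4 else 3)"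

primrec run :: "state \<Rightarrow> (nat \<Rightarrow> int) \<Rightarrow> nat \<Rightarrow> state" where
  "run s a 0 = s"
| "run s a (Suc n) = nxt (run s a n) (a n)"

definition admissible :: "state \<Rightarrow> (nat \<Rightarrow> int) \<Rightarrow> bool" where
  "admissible s a \<longleftrightarrow> (\<forall>n. 1 \<le> a n \<and> a n \<le> max_digit (run s a n))"

lemma run_shift: "run (nxt s (a 0)) (\<lambda>i. a (Suc i)) n = run s a (Suc n)"
  by (induction n) auto

lemma admissible_shift:
  assumes "admissible s a"
  shows "admissible (nxt s (a 0)) (\<lambda>i. a (Suc i))"
  unfolding admissible_def run_shift using assms unfolding admissible_def by blast

lemma admissible_shiftn: "admissible s a \<Longrightarrow> admissible (run s a n) (\<lambda>i. a (i + n))"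
  by (induction n) (auto dest: admissible_shift)

lemma max_digit_le: "max_digit s \<le> 4"
  by (simp add: max_digit_def)

lemma admissible_digit_seq: "admissible s a \<Longrightarrow> digit_seq a"
  unfolding admissible_def digit_seq_def using max_digit_le order_trans by blast

lemma admissible_S0_iff:
  "admissible S0 a \<longleftrightarrow> (\<forall>i. a i \<in> {1, 2, 3, 4} \<and> (a i, a (i+1)) \<noteq> (4, 4) \<and>
     (a i, a (i+1), a (i+2), a (i+3), a (i+4)) \<noteq> (4, 1, 4, 1, 4))" (is "_ \<longleftrightarrow> ?R")
proof
  assume adm: "admissible S0 a"
  show ?R
  proof (intro allI conjI)
    fix i
    have *: "1 \<le> a n" "a n \<le> max_digit (run S0 a n)" for n
      using adm by (auto simp: admissible_def)
    show "a i \<in> {1, 2, 3, 4}" using *[of i] max_digit_le[of "run S0 a i"] by auto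
    show "(a i, a (i+1)) \<noteq> (4, 4)"
      using *(2)[of "Suc i"] by (auto simp: nxt_def max_digit_def split: if_splits)
    show "(a i, a (i+1), a (i+2), a (i+3), a (i+4)) \<noteq> (4, 1, 4, 1, 4)"
      using *(2)[of "i+2"] *(2)[of "i+4"]
      by (cases "run S0 a i")
        (auto simp: nxt_def max_digit_def eval_nat_numeral split: if_splits)
  qed
next
  assume R: ?R
  \<comment> \<open>The state read as a record of the past digits; the lower bounds on
    \<open>n\<close> guard the truncated subtractions.\<close>
  have inv: "(run S0 a n = S4 \<or> run S0 a n = S414 \<longrightarrow> n \<ge> 1 \<and> a (n-1) = 4) \<and>
      (run S0 a n = S41 \<longrightarrow> n \<ge> 2 \<and> a (n-2) = 4 \<and> a (n-1) = 1) \<and>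
      (run S0 a n = S414 \<longrightarrow> n \<ge> 3 \<and> a (n-3) = 4 \<and> a (n-2) = 1) \<and>
      (run S0 a n = S4141 \<longrightarrow> n \<ge> 4 \<and> a (n-4) = 4 \<and> a (n-3) = 1 \<and> a (n-2) = 4 \<and> a (n-1) = 1)" for n
  proof (induction n)
    case 0
    then show ?case by simp
  next
    case (Suc n)
    then show ?case
      by (cases "run S0 a n") (simp_all add: nxt_def numeral_eq_Suc Suc_le_eq)
  qed
  have "1 \<le> a n \<and> a n \<le> max_digit (run S0 a n)" for n
  proof -
    have n: "a n \<in> {1, 2, 3, 4}" using R by blast
    have "a n \<noteq> 4" if "run S0 a n = S4 \<or> run S0 a n = S414"
    proof -
      from inv[of n] that obtain k where "n = k + 1" "a k = 4"
        by (metis add.commute le_add_diff_inverse add_diff_cancel_right')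
      then show ?thesis using R by force
    qed
    moreover have "a n \<noteq> 4" if "run S0 a n = S4141"
    proof -
      from inv[of n] that obtain k where "n = k + 4" "a k = 4" "a (k+1) = 1" "a (k+2) = 4" "a (k+3) = 1"
        by (auto simp: le_iff_add add.commute numeral_eq_Suc)
      then show ?thesis using R by force
    qed
    ultimately show ?thesis using n by (cases "run S0 a n") (auto simp: max_digit_def)
  qed
  then show "admissible S0 a" by (simp add: admissible_def)
qed

text \<open>The extreme tails are the six rotations of the purely periodic continued fraction with
  period \<open>1, 4, 1, 4, 1, 3\<close>; the numbers below are the roots of the resulting quadratic equations.\<close>

definition lo :: "state \<Rightarrow> real" where
  "lo s = (case s of S4 \<Rightarrow> (115 + sqrt 26565) / 230 | S414 \<Rightarrow> (117 + sqrt 26565) / 222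
                   | _ \<Rightarrow> (105 + sqrt 26565) / 222)"

definition hi :: "state \<Rightarrow> real" where
  "hi s = (case s of S0 \<Rightarrow> (117 + sqrt 26565) / 58 | S41 \<Rightarrow> (115 + sqrt 26565) / 58
                   | _ \<Rightarrow> (105 + sqrt 26565) / 70)"

lemma sqrt_26565_bounds: "162987/1000 \<le> sqrt 26565" "sqrt 26565 \<le> 162988/1000"
  by (rule real_le_rsqrt, simp add: power2_eq_square) (rule real_le_lsqrt, simp_all add: power2_eq_square)

lemma sqrt_26565_sq: "sqrt 26565 * sqrt 26565 = 26565"
  by simp

text \<open>Reciprocals of extreme values are again linear in \<open>sqrt 26565\<close>, so later
  estimates only need rational bounds for that root.\<close>

lemma inverse_hi:
  "1 / hi s = (case s of S0 \<Rightarrow> lo S0 | S41 \<Rightarrow> lo S4 | _ \<Rightarrow> lo S414) - 1"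
proof -
  have "0 < 105 + sqrt 26565" "0 < 115 + sqrt 26565" "0 < 117 + sqrt 26565"
    using sqrt_26565_bounds by auto
  then show ?thesis
    using sqrt_26565_sq by (cases s) (auto simp: lo_def hi_def field_simps)
qed

lemma inverse_lo:
  "1 / lo s = (case s of S4 \<Rightarrow> hi S0 - 4 | S414 \<Rightarrow> hi S41 - 4 | _ \<Rightarrow> hi S4 - 3)"
proof -
  have "0 < 105 + sqrt 26565" "0 < 115 + sqrt 26565" "0 < 117 + sqrt 26565"
    using sqrt_26565_bounds by auto
  then show ?thesis
    using sqrt_26565_sq by (cases s) (auto simp: lo_def hi_def field_simps)
qed

text \<open>The greedy rule: a minimal tail is 1 followed by a maximal tail, and a maximal tail is
  the largest allowed digit followed by a minimal one. From \<open>S0\<close> this alternation reads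
  1, 4, 1, 4, 1, 3 and returns to \<open>S0\<close>, which is the origin of the period.\<close>

lemma lo_eq: "lo s = 1 + 1 / hi (nxt s 1)"
  unfolding inverse_hi by (cases s) (auto simp: nxt_def lo_def)

lemma hi_eq: "hi s = of_int (max_digit s) + 1 / lo (nxt s (max_digit s))"
  unfolding inverse_lo by (cases s) (auto simp: nxt_def max_digit_def hi_def)

lemma lo_bounds: "1207/1000 \<le> lo s" "lo s \<le> 12613/10000"
  using sqrt_26565_bounds by (cases s; simp add: lo_def)+

lemma hi_bounds: "3828/1000 \<le> hi s" "hi s \<le> 4828/1000"
  using sqrt_26565_bounds by (cases s; simp add: hi_def)+

lemma inverse_hi_bounds: "207/1000 \<le> 1 / hi s" "1 / hi s \<le> 2613/10000"
  unfolding inverse_hi using lo_bounds[of S0] lo_bounds[of S4] lo_bounds[of S414]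
  by (cases s; simp)+

lemma inverse_lo_bounds: "7928/10000 \<le> 1 / lo s" "1 / lo s \<le> 8285/10000"
  unfolding inverse_lo using sqrt_26565_bounds by (cases s; simp add: hi_def)+

text \<open>An infinite sequence offers no base case for the greedy argument. A slack that is
  harmless at \<open>n = 0\<close>, by the crude bounds on \<open>cfval\<close>, and contracts by
  5/6 with each digit supplies one; it tends to 0 in \<open>cfval_hull\<close>.\<close>

lemma cfval_approx_hull:
  "admissible s a \<Longrightarrow> lo s - 4 * (5/6) ^ n \<le> cfval a \<and> cfval a \<le> hi s + 4 * (5/6) ^ n"
proof (induction n arbitrary: s a)
  case 0
  then show ?case
    using cfval_bounds[OF admissible_digit_seq[OF 0]] lo_bounds[of s] hi_bounds[of s] by auto
next
  case (Suc n)
  let ?s = "nxt s (a 0)" and ?b = "\<lambda>i. a (Suc i)"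
  let ?t = "cfval ?b" and ?e = "4 * (5/6 :: real) ^ n"
  have b: "admissible ?s ?b" using admissible_shift[OF Suc.prems] .
  have t: "6/5 \<le> ?t" using cfval_bounds(1)[OF admissible_digit_seq[OF b]] .
  have IH: "lo ?s - ?e \<le> ?t" "?t \<le> hi ?s + ?e" using Suc.IH[OF b] by auto
  have a0: "1 \<le> a 0" "a 0 \<le> max_digit s"
    using Suc.prems by (auto simp: admissible_def dest: spec[of _ 0])
  have e: "0 \<le> ?e" by simp
  have val: "cfval a = of_int (a 0) + 1 / ?t"
    using cfval_shift[OF admissible_digit_seq[OF Suc.prems]] .
  have up: "1 / ?t \<le> 1 / lo ?s + 5/6 * ?e"
  proof (cases "lo ?s \<le> ?t")
    case True
    then have "1 / ?t \<le> 1 / lo ?s" using lo_bounds[of ?s] by (intro divide_left_mono) auto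
    then show ?thesis using e by linarith
  next
    case False
    have "\<bar>1 / ?t - 1 / lo ?s\<bar> \<le> 5/6 * \<bar>?t - lo ?s\<bar>"
      using t lo_bounds[of ?s] by (intro inverse_diff_le) auto
    then show ?thesis using False IH(1) by (auto simp: abs_if split: if_splits)
  qed
  have low: "1 / hi ?s - 5/6 * ?e \<le> 1 / ?t"
  proof (cases "?t \<le> hi ?s")
    case True
    then have "1 / hi ?s \<le> 1 / ?t" using t hi_bounds[of ?s] by (intro divide_left_mono) auto
    then show ?thesis using e by linarith
  next
    case False
    have "\<bar>1 / ?t - 1 / hi ?s\<bar> \<le> 5/6 * \<bar>?t - hi ?s\<bar>"
      using t hi_bounds[of ?s] by (intro inverse_diff_le) auto
    then show ?thesis using False IH(2) by (auto simp: abs_if split: if_splits)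
  qed
  \<comment> \<open>A digit below the maximum loses at least 1, more than the whole variation of
    \<open>1 / lo\<close> over the states, so the greedy digit wins.\<close>
  have "of_int (a 0) + 1 / lo ?s \<le> hi s"
  proof (cases "a 0 = max_digit s")
    case True
    then show ?thesis using hi_eq[of s] by simp
  next
    case False
    then have "of_int (a 0) + 1 \<le> (of_int (max_digit s) :: real)" using a0 by linarith
    then show ?thesis
      using hi_eq[of s] inverse_lo_bounds[of ?s] inverse_lo_bounds[of "nxt s (max_digit s)"] by linarith
  qed
  moreover have "lo s \<le> of_int (a 0) + 1 / hi ?s"
  proof (cases "a 0 = 1")
    case True
    then show ?thesis using lo_eq[of s] by simp
  next
    case False
    then have "(2::real) \<le> of_int (a 0)" using a0 by linarith
    then show ?thesis
      using lo_eq[of s] inverse_hi_bounds[of ?s] inverse_hi_bounds[of "nxt s 1"] by linarith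
  qed
  ultimately show ?case using val up low by simp
qed

lemma cfval_hull:
  assumes "admissible s a"
  shows "lo s \<le> cfval a" "cfval a \<le> hi s"
proof -
  have e: "(\<lambda>n. 4 * (5/6::real) ^ n) \<longlonglongrightarrow> 4 * 0"
    by (intro tendsto_intros LIMSEQ_power_zero) simp
  show "lo s \<le> cfval a"
    using cfval_approx_hull[OF assms]
    by (intro LIMSEQ_le_const2[OF tendsto_diff[OF tendsto_const e], of "lo s" "cfval a", simplified]) auto
  show "cfval a \<le> hi s"
    using cfval_approx_hull[OF assms]
    by (intro LIMSEQ_le_const[OF tendsto_add[OF tendsto_const e], of "cfval a" "hi s", simplified]) auto
qed

section \<open>Values of the periodic continued fractions\<close>

lemma periodic_seq_Cons_shift:
  "(\<lambda>i. periodic_seq (u # us) vs (Suc i)) = periodic_seq us vs"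
  by (auto simp: periodic_seq_def fun_eq_iff)

lemma periodic_seq_unroll:
  "vs \<noteq> [] \<Longrightarrow> periodic_seq [] vs = periodic_seq vs vs"
  by (auto simp: periodic_seq_def fun_eq_iff le_mod_geq)

lemma digit_seq_periodic:
  assumes "vs \<noteq> []" "set us \<subseteq> {1..4}" "set vs \<subseteq> {1..4}"
  shows "digit_seq (periodic_seq us vs)"
  unfolding digit_seq_def
proof
  fix i
  have "us ! i \<in> set us" if "i < length us" using that by simp
  moreover have "vs ! ((i - length us) mod length vs) \<in> set vs" using assms(1) by simp
  ultimately have "periodic_seq us vs i \<in> {1..4}"
    using assms(2,3) unfolding periodic_seq_def by (auto simp del: nth_mem)
  then show "1 \<le> periodic_seq us vs i \<and> periodic_seq us vs i \<le> 4" by simp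
qed

lemma cfval_periodic_Cons:
  assumes "vs \<noteq> []" "set (u # us) \<subseteq> {1..4}" "set vs \<subseteq> {1..4}"
  shows "cfval (periodic_seq (u # us) vs) = of_int u + 1 / cfval (periodic_seq us vs)"
  using cfval_shift[OF digit_seq_periodic[OF assms]]
  by (simp add: periodic_seq_Cons_shift) (simp add: periodic_seq_def)

lemma cfval_periodic_lo: "cfval (periodic_seq [] [1, 4, 1, 4, 1, 3]) = lo S0" (is "?t = _")
  and cfval_periodic_hi: "cfval (periodic_seq [] [4, 1, 4, 1, 3, 1]) = hi S0" (is "?r = _")
proof -
  show "?t = lo S0"
  proof -
    have t: "?t > 0"
      using cfval_bounds(1)[OF digit_seq_periodic[of "[1, 4, 1, 4, 1, 3]" "[]"]] by simp
    have "?t = 1 + 1 / (4 + 1 / (1 + 1 / (4 + 1 / (1 + 1 / (3 + 1 / ?t)))))"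
      by (subst periodic_seq_unroll) (simp_all add: cfval_periodic_Cons)
    then have "111 * ?t\<^sup>2 - 105 * ?t - 35 = 0"
      using t by (simp add: divide_simps add_pos_pos power2_eq_square) (simp add: algebra_simps)
    then have "(222 * ?t - 105)\<^sup>2 = 26565" by (simp add: power2_eq_square algebra_simps)
    moreover have "222 * ?t - 105 \<ge> 0"
      using cfval_bounds(1)[OF digit_seq_periodic[of "[1, 4, 1, 4, 1, 3]" "[]"]] by simp
    ultimately have "222 * ?t - 105 = sqrt 26565" by (metis real_sqrt_unique)
    then show ?thesis by (simp add: lo_def)
  qed
  show "?r = hi S0"
  proof -
    have r: "?r > 0"
      using cfval_bounds(1)[OF digit_seq_periodic[of "[4, 1, 4, 1, 3, 1]" "[]"]] by simp
    have eq: "?r = 4 + 1 / (1 + 1 / (4 + 1 / (1 + 1 / (3 + 1 / (1 + 1 / ?r)))))"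
      by (subst periodic_seq_unroll) (simp_all add: cfval_periodic_Cons)
    then have "29 * ?r\<^sup>2 - 117 * ?r - 111 = 0"
      using r by (simp add: divide_simps add_pos_pos power2_eq_square) (simp add: algebra_simps)
    then have "(58 * ?r - 117)\<^sup>2 = 26565" by (simp add: power2_eq_square algebra_simps)
    \<comment> \<open>Selecting the positive root needs \<open>?r\<close> above 117/58, for which
      the general bound \<open>6/5\<close> is too weak; the leading digit 4 gives it.\<close>
    moreover have r4: "?r \<ge> 4"
      by (subst eq) (use r in \<open>auto intro!: divide_nonneg_nonneg add_nonneg_nonneg\<close>)
    moreover from r4 have "58 * ?r - 117 \<ge> 0" by simp
    ultimately have "58 * ?r - 117 = sqrt 26565" by (metis real_sqrt_unique)
    then show ?thesis by (simp add: hi_def)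
  qed
qed

section \<open>Moebius maps of words and the comparison of gaps with bridges\<close>

text \<open>Words are stored with their last digit first.  The two linear forms swap roles with every
  digit, so that \<open>mob\<close> has determinant 1 and is increasing for all words; the value of the
  continued fraction is \<open>mob\<close> or its inverse, depending on the parity of the length.\<close>

primrec coef :: "int list \<Rightarrow> bool \<Rightarrow> real \<times> real" where
  "coef [] b = (if b then (1, 0) else (0, 1))"
| "coef (d # w) b = (of_int d * fst (coef w (\<not> b)) + snd (coef w (\<not> b)), fst (coef w (\<not> b)))"

definition lin :: "int list \<Rightarrow> bool \<Rightarrow> real \<Rightarrow> real" where
  "lin w b t = fst (coef w b) * t + snd (coef w b)"

definition mob :: "int list \<Rightarrow> real \<Rightarrow> real" where
  "mob w t = lin w True t / lin w False t"

definition cfw :: "int list \<Rightarrow> real \<Rightarrow> real" where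
  "cfw w t = (if even (length w) then mob w t else 1 / mob w t)"

lemma lin_Cons: "t \<noteq> 0 \<Longrightarrow> lin (d # w) b t = t * lin w (\<not> b) (of_int d + 1 / t)"
  by (simp add: lin_def field_simps)

lemma mob_Cons: "t \<noteq> 0 \<Longrightarrow> mob (d # w) t = 1 / mob w (of_int d + 1 / t)"
  by (simp add: mob_def lin_Cons)

lemma cfw_Nil: "cfw [] t = t"
  by (simp add: cfw_def mob_def lin_def)

lemma cfw_Cons: "t \<noteq> 0 \<Longrightarrow> cfw (d # w) t = cfw w (of_int d + 1 / t)"
  by (simp add: cfw_def mob_Cons)

lemma coef_det:
  "fst (coef w True) * snd (coef w False) - snd (coef w True) * fst (coef w False) = 1"
  by (induction w) (auto simp: algebra_simps)

section \<open>Admissible words and the size of their coefficients\<close>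

definition st :: "int list \<Rightarrow> state" where
  "st w = foldr (\<lambda>d s. nxt s d) w S0"

lemma st_Cons [simp]: "st (d # w) = nxt (st w) d"
  by (simp add: st_def)

lemma st_43: "st [3, 4] = S0"
  by (simp add: st_def nxt_def)

inductive good :: "int list \<Rightarrow> bool" where
  start: "good [3, 4]"
| Cons: "good w \<Longrightarrow> 1 \<le> d \<Longrightarrow> d \<le> max_digit (st w) \<Longrightarrow> good (d # w)"

text \<open>A lower bound for the quotients \<open>[0; d\<^sub>n, d\<^sub>n\<^sub>-\<^sub>1, \<dots>]\<close> of consecutive continuants
  of a word whose last digits are recorded by the state.\<close>

definition crat :: "state \<Rightarrow> real" where
  "crat s = (if s = S41 \<or> s = S4141 then 4/5 else 1/5)"

lemma crat_bounds: "1/5 \<le> crat s" "crat s \<le> 4/5"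
  by (auto simp: crat_def)

text \<open>Appending \<open>d\<close> turns the coefficient quotient \<open>q\<close> into
  \<open>1 / (d + q)\<close>, which is at least 1/5. After a digit 4 it is at most 1/4, so a
  following 1 makes it at least 4/5; the last conjunct carries this information across one step. The
  induction starts at \<open>[3, 4]\<close> since \<open>fst (coef [] False)\<close> is 0.\<close>

lemma good_coef_aux:
  assumes "good w"
  shows "(6/5) ^ length w \<le> fst (coef w b) \<and> fst (coef w b) \<le> 5 ^ length w \<and>
         crat (st w) * fst (coef w b) \<le> snd (coef w b) \<and> snd (coef w b) \<le> fst (coef w b) \<and>
         (st w = S4 \<or> st w = S414 \<longrightarrow> 4 * snd (coef w b) \<le> fst (coef w b))"
  using assms
proof (induction arbitrary: b)
  case start
  then show ?case by (cases b) (simp_all add: st_43 crat_def power2_eq_square del: st_Cons)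
next
  case (Cons w d)
  define a where "a = fst (coef w (\<not> b))"
  define a' where "a' = snd (coef w (\<not> b))"
  have IH: "(6/5) ^ length w \<le> a" "a \<le> 5 ^ length w" "crat (st w) * a \<le> a'" "a' \<le> a"
    "st w = S4 \<or> st w = S414 \<Longrightarrow> 4 * a' \<le> a"
    using Cons.IH[of "\<not> b"] unfolding a_def a'_def by auto
  have a: "0 < a" using IH(1) less_le_trans[of 0 "(6/5) ^ length w" a] by simp
  have a': "1/5 * a \<le> a'"
    using IH(3) mult_right_mono[OF crat_bounds(1)[of "st w"], of a] a by linarith
  have d: "1 \<le> real_of_int d" "real_of_int d \<le> 4"
    using Cons.hyps max_digit_le[of "st w"] by linarith+
  have da: "a \<le> d * a" "d * a \<le> 4 * a" using d a by auto
  have 1: "(6/5) * (6/5) ^ length w \<le> d * a + a'" using IH(1) a' da by linarith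
  have 2: "d * a + a' \<le> 5 * 5 ^ length w" using IH(2,4) da by linarith
  have 3: "crat (nxt (st w) d) * (d * a + a') \<le> a"
  proof (cases "nxt (st w) d = S41 \<or> nxt (st w) d = S4141")
    case True
    then have "d = 1" "st w = S4 \<or> st w = S414" by (auto simp: nxt_def split: if_splits)
    with IH(5) True show ?thesis by (simp add: crat_def)
  next
    case False
    then have "crat (nxt (st w) d) * (real_of_int d * a + a') = 1/5 * (d * a + a')" by (simp add: crat_def)
    moreover have "1/5 * (d * a + a') \<le> a" using da IH(4) by simp
    ultimately show ?thesis by (rule ord_eq_le_trans)
  qed
  have 4: "a \<le> d * a + a'" using da a' a by linarith
  have 5: "4 * a \<le> d * a + a'" if "nxt (st w) d = S4 \<or> nxt (st w) d = S414"
  proof -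
    have "d = 4" using that by (auto simp: nxt_def split: if_splits)
    then show ?thesis using a' a by simp
  qed
  show ?case using 1 2 3 4 5 unfolding coef.simps st_Cons fst_conv snd_conv a_def[symmetric] a'_def[symmetric]
    by simp
qed

lemma good_coef:
  assumes "good w"
  shows "(6/5) ^ length w \<le> fst (coef w b)" "fst (coef w b) \<le> 5 ^ length w" "0 < fst (coef w b)"
    "crat (st w) * fst (coef w b) \<le> snd (coef w b)" "snd (coef w b) \<le> fst (coef w b)"
    "1/5 * fst (coef w b) \<le> snd (coef w b)"
proof -
  show 0: "0 < fst (coef w b)"
    using good_coef_aux[OF assms, of b] less_le_trans[of 0 "(6/5) ^ length w" "fst (coef w b)"] by simp
  show "1/5 * fst (coef w b) \<le> snd (coef w b)"
    using good_coef_aux[OF assms, of b] 0 mult_right_mono[OF crat_bounds(1)[of "st w"], of "fst (coef w b)"]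
    by linarith
qed (use good_coef_aux[OF assms, of b] in auto)

lemma lin_pos: "good w \<Longrightarrow> 0 < t \<Longrightarrow> 0 < lin w b t"
  using good_coef(3,6)[of w b] by (simp add: lin_def add_pos_nonneg)

lemma mob_pos: "good w \<Longrightarrow> 0 < t \<Longrightarrow> 0 < mob w t"
  by (simp add: mob_def lin_pos)

text \<open>The relative length of the image under \<open>mob w\<close> of the interval from
  \<open>s\<close> to \<open>t\<close>, as \<open>mob_ratio\<close> shows for good words.
  Determinant 1 keeps the word out of the numerator.\<close>

definition gap :: "int list \<Rightarrow> real \<Rightarrow> real \<Rightarrow> real" where
  "gap w s t = (t - s) / (lin w True s * lin w False t)"

lemma mob_ratio:
  assumes "good w" "0 < s" "0 < t"
  shows "mob w t / mob w s = 1 + gap w s t"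
proof -
  note pos = lin_pos[OF assms(1,2)] lin_pos[OF assms(1,3)]
  have "lin w True t * lin w False s - lin w True s * lin w False t
    = (t - s) * (fst (coef w True) * snd (coef w False) - snd (coef w True) * fst (coef w False))"
    by (simp add: lin_def algebra_simps)
  also have "\<dots> = t - s" by (simp add: coef_det)
  finally have "t - s = lin w True t * lin w False s - lin w True s * lin w False t" by simp
  then show ?thesis using pos[of True] pos[of False] by (simp add: gap_def mob_def field_simps)
qed

lemma mob_mono:
  assumes "good w" "0 < s" "s \<le> t"
  shows "mob w s \<le> mob w t"
proof -
  have "0 \<le> gap w s t"
    using assms lin_pos[OF assms(1), of s True] lin_pos[OF assms(1), of t False] by (simp add: gap_def)
  then have "1 \<le> mob w t / mob w s" using mob_ratio[OF assms(1), of s t] assms by simp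
  then show ?thesis using mob_pos[OF assms(1,2)] by simp
qed

lemma lin_mono: "good w \<Longrightarrow> 0 < s \<Longrightarrow> s \<le> t \<Longrightarrow> lin w b s \<le> lin w b t"
  using good_coef(3)[of w b] by (simp add: lin_def)

text \<open>Among all words with a given lower bound for the ratio of their coefficients,
  the comparison of a gap with its outer bridge is worst when the ratio attains the bound.\<close>

lemma lin_ratio_le:
  assumes "good w" "c = crat (st w)" "0 < s" "s \<le> t"
  shows "lin w b t * (s + c) \<le> lin w b s * (t + c)"
proof -
  have "lin w b t * (s + c) - lin w b s * (t + c) = (t - s) * (c * fst (coef w b) - snd (coef w b))"
    by (simp add: lin_def algebra_simps)
  also have "\<dots> \<le> 0" using assms good_coef(4)[OF assms(1), of b] by (intro mult_nonneg_nonpos) auto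
  finally show ?thesis by simp
qed

lemma gap_le_outer:
  assumes "good w" "c = crat (st w)" "0 < x" "x \<le> y" "y \<le> z"
    and "(y - x) * (z + c) \<le> (z - y) * (x + c)"
  shows "gap w x y \<le> gap w y z"
proof -
  let ?P = "lin w True y" and ?P2 = "lin w True x" and ?Q = "lin w False z" and ?Q2 = "lin w False y"
  have pos: "0 < ?P" "0 < ?P2" "0 < ?Q" "0 < ?Q2" using assms lin_pos[OF assms(1)] by auto
  have c: "0 < c" using assms(2) crat_bounds[of "st w"] by simp
  have 1: "?P * (x + c) \<le> ?P2 * (y + c)" using lin_ratio_le assms by simp
  have 2: "?Q * (y + c) \<le> ?Q2 * (z + c)" using lin_ratio_le assms by simp
  \<comment> \<open>The ratio bounds \<open>(y + c) / (x + c)\<close> and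
    \<open>(z + c) / (y + c)\<close> telescope to \<open>(z + c) / (x + c)\<close>, which the last
    hypothesis absorbs.\<close>
  have "(y - x) * (?P * (x + c)) * (?Q * (y + c)) \<le> (y - x) * (?P2 * (y + c)) * (?Q2 * (z + c))"
    using 1 2 pos c assms by (intro mult_mono[OF mult_left_mono[OF 1] 2] mult_nonneg_nonneg) auto
  also have "\<dots> = ((y - x) * (z + c)) * (?P2 * ?Q2 * (y + c))" by simp
  also have "\<dots> \<le> ((z - y) * (x + c)) * (?P2 * ?Q2 * (y + c))"
    using assms pos c by (intro mult_right_mono) auto
  finally have "((y - x) * ?P * ?Q) * ((x + c) * (y + c)) \<le> ((z - y) * ?P2 * ?Q2) * ((x + c) * (y + c))"
    by (simp add: mult_ac)
  then have "(y - x) * ?P * ?Q \<le> (z - y) * ?P2 * ?Q2"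
    using assms c by (subst (asm) mult_le_cancel_right_pos) auto
  then show ?thesis using pos by (simp add: gap_def field_simps)
qed

text \<open>Both linear forms increase, so the denominators favour the inner bridge and comparing
  the lengths of the tail intervals suffices.\<close>

lemma gap_le_inner:
  assumes "good w" "0 < x" "x \<le> y" "y \<le> z" "z - y \<le> y - x"
  shows "gap w y z \<le> gap w x y"
  unfolding gap_def
  using assms lin_pos[OF assms(1)] lin_mono[OF assms(1)] by (intro frac_le mult_mono) (auto simp: less_imp_le)

text \<open>The digit cylinders of a state: tails in state \<open>s\<close> beginning with \<open>d\<close> fill the hull
  from \<open>digit_lo s d\<close> to \<open>digit_hi s d\<close>.\<close>

definition digit_lo :: "state \<Rightarrow> int \<Rightarrow> real" where
  "digit_lo s d = of_int d + 1 / hi (nxt s d)"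

definition digit_hi :: "state \<Rightarrow> int \<Rightarrow> real" where
  "digit_hi s d = of_int d + 1 / lo (nxt s d)"

lemma digit_lo_1: "digit_lo s 1 = lo s"
  by (simp add: digit_lo_def lo_eq)

lemma digit_hi_max: "digit_hi s (max_digit s) = hi s"
  by (simp add: digit_hi_def hi_eq)

lemma digit_lo_bounds: "of_int d + 207/1000 \<le> digit_lo s d" "digit_lo s d \<le> of_int d + 2613/10000"
  using inverse_hi_bounds[of "nxt s d"] by (auto simp: digit_lo_def)

lemma digit_hi_bounds: "of_int d + 7928/10000 \<le> digit_hi s d" "digit_hi s d \<le> of_int d + 8285/10000"
  using inverse_lo_bounds[of "nxt s d"] by (auto simp: digit_hi_def)

section \<open>Numerical comparison of gaps with bridges and with child gaps\<close>

lemma hi_ge: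
  assumes "k + 1 < max_digit s"
  shows "of_int k + 27928/10000 \<le> hi s"
proof -
  have "of_int k + 2 \<le> (of_int (max_digit s) :: real)" using assms by linarith
  then show ?thesis using digit_hi_bounds(1)[where s = s and d = "max_digit s"] digit_hi_max[of s] by simp
qed

text \<open>Separate bounds on the four factors avoid products of irrational terms in the numerical
  goals.\<close>

lemma mult_le_mult_bounds:
  assumes "x \<le> p" "y \<le> q" "p' \<le> x'" "q' \<le> y'" "p * q \<le> p' * q'" "0 \<le> p" "0 \<le> y" "0 \<le> p'" "0 \<le> q'"
  shows "x * y \<le> x' * (y' :: real)"
  using mult_mono[of x p y q] mult_mono[of p' x' q' y'] assms by linarith

text \<open>This is the last hypothesis of \<open>gap_le_outer\<close>. It is tight when
  \<open>k + 1\<close> is the largest digit, as the bridge is then a single cylinder: for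
  \<open>s = S41\<close> and \<open>k = 3\<close> it would fail with 1/5 in place of
  \<open>crat s = 4/5\<close>.\<close>

lemma outer_bridge_numeric:
  assumes k: "1 \<le> k" "k < max_digit s"
  shows "(digit_lo s (k + 1) - digit_hi s k) * (hi s + crat s) \<le> (hi s - digit_lo s (k + 1)) * (digit_hi s k + crat s)"
proof (cases "max_digit s = k + 1")
  case True
  note ends = digit_lo_def[unfolded inverse_hi] digit_hi_def[unfolded inverse_lo]
  note defs = ends nxt_def hi_def lo_def crat_def
  from True have "k = max_digit s - 1" by simp
  then consider "k = 2" "s = S4 \<or> s = S414" | "k = 2" "s = S4141" | "k = 3" "s = S0" | "k = 3" "s = S41"
    by (cases s) (simp_all add: max_digit_def)
  then show ?thesis
  proof cases
    case 1
    from 1(2) have *: "crat s = 1/5" "hi s = (105 + sqrt 26565) / 70"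
        "digit_lo s 3 = 2 + (105 + sqrt 26565) / 222" "digit_hi s 2 = (105 + sqrt 26565) / 70 - 1"
      by (auto simp: defs)
    show ?thesis unfolding 1(1)
      by (rule mult_le_mult_bounds[of _ "379/1000" _ "4029/1000" "621/1000" _ "3028/1000"])
        (use sqrt_26565_bounds in \<open>simp_all add: *\<close>)
  next
    case 2
    show ?thesis unfolding 2
      by (rule mult_le_mult_bounds[of _ "379/1000" _ "4629/1000" "621/1000" _ "3028/1000"])
        (use sqrt_26565_bounds in \<open>simp_all add: defs field_simps\<close>)
  next
    case 3
    show ?thesis unfolding 3
      by (rule mult_le_mult_bounds[of _ "433/1000" _ "5028/1000" "566/1000" _ "4028/1000"])
        (use sqrt_26565_bounds in \<open>simp_all add: defs field_simps\<close>)
  next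
    case 4
    show ?thesis unfolding 4
      by (rule mult_le_mult_bounds[of _ "433/1000" _ "5593/1000" "5316/10000" _ "4628/1000"])
        (use sqrt_26565_bounds in \<open>simp_all add: defs field_simps\<close>)
  qed
next
  case False
  have g: "digit_lo s (k + 1) \<le> of_int k + 12613/10000" "of_int k + 7928/10000 \<le> digit_hi s k"
      "of_int k + 27928/10000 \<le> hi s" "digit_hi s k \<le> of_int k + 8285/10000"
      "of_int k + 1207/1000 \<le> digit_lo s (k + 1)"
    using digit_lo_bounds[where s = s and d = "k+1"] digit_hi_bounds[where s = s and d = k] hi_ge[of k s] False k by auto
  have k1: "1 \<le> (of_int k :: real)" using k(1) by linarith
  note c = crat_bounds[of s]
  \<comment> \<open>Subtracting gap times bridge from both sides leaves \<open>hi s\<close> only on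
    the right, so its lower bound is enough.\<close>
  have "(digit_lo s (k + 1) - digit_hi s k) * (digit_lo s (k + 1) + crat s)
      \<le> (hi s - digit_lo s (k + 1)) * (2 * digit_hi s k - digit_lo s (k + 1) + crat s)"
    by (rule mult_le_mult_bounds[of _ "4685/10000" _ "of_int k + 12613/10000 + crat s"
          "15315/10000" _ "of_int k + 3243/10000 + crat s"]) (use g k1 c in auto)
  then show ?thesis by (simp add: algebra_simps)
qed

lemma digit_gap_bounds:
  "3785/10000 \<le> digit_lo s (k + 1) - digit_hi s k" "digit_lo s (k + 1) - digit_hi s k \<le> 4685/10000"
  using digit_lo_bounds[where s = s and d = "k+1"] digit_hi_bounds[where s = s and d = k] by auto

lemma lin_scale:
  assumes "good w" "0 < s" "t \<le> q * s" "1 \<le> q"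
  shows "lin w b t \<le> q * lin w b s"
proof -
  have "fst (coef w b) * t \<le> fst (coef w b) * (q * s)"
    using good_coef(3)[OF assms(1), of b] assms(3) by simp
  moreover have "snd (coef w b) \<le> q * snd (coef w b)"
    using good_coef(3,6)[OF assms(1), of b] assms(4) mult_right_mono[of 1 q "snd (coef w b)"] by simp
  ultimately show ?thesis by (simp add: lin_def algebra_simps)
qed

text \<open>The next tail gap may be longer, by a factor of at most 4685/3785 < 1.238. The first
  linear form alone grows by 1.238 from one digit to the next, which uses that \<open>k\<close> is
  at most 2.\<close>

lemma gap_next_digit:
  assumes "good w" "1 \<le> k" "k + 1 < max_digit (st w)"
  shows "gap w (digit_hi (st w) (k + 1)) (digit_lo (st w) (k + 2)) \<le> gap w (digit_hi (st w) k) (digit_lo (st w) (k + 1))"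
proof -
  let ?s = "st w"
  let ?x = "digit_hi ?s k" and ?y = "digit_lo ?s (k + 1)" and ?x' = "digit_hi ?s (k + 1)" and ?y' = "digit_lo ?s (k + 2)"
  let ?a = "fst (coef w True)" and ?a' = "snd (coef w True)"
  have k: "1 \<le> (of_int k :: real)" "of_int k \<le> (2 :: real)"
    using assms max_digit_le[of ?s] by linarith+
  have g: "?y' - ?x' \<le> 4685/10000" "3785/10000 \<le> ?y - ?x"
    using digit_gap_bounds[of ?s "k+1"] digit_gap_bounds[of ?s k] by (simp_all add: add.commute)
  have x: "of_int k + 7928/10000 \<le> ?x" "?x \<le> of_int k + 8285/10000" "of_int k + 17928/10000 \<le> ?x'"
    using digit_hi_bounds[where s = ?s and d = k] digit_hi_bounds[where s = ?s and d = "k+1"] by auto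
  have y: "?y \<le> ?y'" "0 < ?y"
    using digit_lo_bounds[where s = ?s and d = "k+2"] digit_lo_bounds[where s = ?s and d = "k+1"] k by auto
  have "0 < ?x" "0 < ?x'" using x k by auto
  note pos = lin_pos[OF assms(1) this(1), of True] lin_pos[OF assms(1) this(2), of True]
    lin_pos[OF assms(1) y(2), of False]
  have a: "0 < ?a" "?a' \<le> ?a" "0 \<le> ?a'" using good_coef(3,5,6)[OF assms(1), of True] by auto
  have "1238/1000 * (?a * ?x + ?a') \<le> ?a * ?x' + ?a'"
  proof -
    have "238/1000 * ?a' \<le> 238/1000 * ?a" using a by simp
    moreover have "?a * (1238/1000 * ?x + 238/1000) \<le> ?a * ?x'" using x k a by (intro mult_left_mono) auto
    ultimately show ?thesis by (simp add: algebra_simps)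
  qed
  then have "1238/1000 * lin w True ?x \<le> lin w True ?x'" by (simp add: lin_def)
  moreover have "lin w False ?y \<le> lin w False ?y'" using lin_mono[OF assms(1)] y by simp
  ultimately have "(1238/1000 * lin w True ?x) * lin w False ?y \<le> lin w True ?x' * lin w False ?y'"
    using pos by (intro mult_mono) auto
  then have "gap w ?x' ?y' \<le> (4685/10000) / ((1238/1000 * lin w True ?x) * lin w False ?y)"
    unfolding gap_def using g pos by (intro frac_le) auto
  also have "\<dots> \<le> (3785/10000) / (lin w True ?x * lin w False ?y)"
    using pos by (simp add: divide_simps)
  also have "\<dots> \<le> gap w ?x ?y" unfolding gap_def using g pos by (intro divide_right_mono) auto
  finally show ?thesis .
qed

text \<open>The first gap inside the cylinder of the digit \<open>j\<close>, in the coordinates of the parent.\<close>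

lemma child_gap_numeric:
  fixes s j
  defines "x \<equiv> of_int j + 1 / digit_lo s 2" and "y \<equiv> of_int j + 1 / digit_hi s 1"
  shows "y - x \<le> 12/100" "of_int j + 44/100 \<le> x" "x \<le> y" "of_int j + 54/100 \<le> y"
proof -
  let ?u = "digit_hi s 1" and ?v = "digit_lo s 2"
  have u: "17928/10000 \<le> ?u" "?u \<le> 18285/10000" using digit_hi_bounds[where s = s and d = 1] by auto
  have v: "2207/1000 \<le> ?v" "?v \<le> 22613/10000" using digit_lo_bounds[where s = s and d = 2] by auto
  have "1 / ?u - 1 / ?v = (?v - ?u) / (?u * ?v)" using u v by (simp add: field_simps)
  also have "\<dots> \<le> (4685/10000) / ((17928/10000) * (2207/1000))"
    using u v by (intro frac_le mult_mono) auto
  finally show "y - x \<le> 12/100" by (simp add: x_def y_def)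
  show "of_int j + 44/100 \<le> x" using v by (simp add: x_def field_simps)
  show "of_int j + 54/100 \<le> y" using u by (simp add: y_def field_simps)
  show "x \<le> y" using u v by (simp add: x_def y_def frac_le)
qed

text \<open>The child's gap lies at smaller tails, where the denominators shrink by a factor of at
  most 1.3 * 1.5 = 1.95. Its length is at most 0.12 against at least 0.3785 for the parent, which
  outweighs this loss.\<close>

lemma gap_inner_child:
  assumes "good w" "1 \<le> k" "k < max_digit (st w)"
  shows "gap w (of_int k + 1 / digit_lo s 2) (of_int k + 1 / digit_hi s 1)
       \<le> gap w (digit_hi (st w) k) (digit_lo (st w) (k + 1))"
proof -
  let ?x' = "of_int k + 1 / digit_lo s 2" and ?y' = "of_int k + 1 / digit_hi s 1"
  let ?x = "digit_hi (st w) k" and ?y = "digit_lo (st w) (k + 1)"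
  note n = child_gap_numeric[where j = k and s = s]
  have k: "1 \<le> (of_int k :: real)" using assms by linarith
  have g: "3785/10000 \<le> ?y - ?x" using digit_gap_bounds[of "st w" k] by simp
  have "0 < ?x" "0 < ?y" "0 < ?x'" "0 < ?y'"
    using digit_hi_bounds[where s = "st w" and d = k] digit_lo_bounds[where s = "st w" and d = "k+1"] n k by auto
  note pos = lin_pos[OF assms(1) this(1), of True] lin_pos[OF assms(1) this(2), of False]
    lin_pos[OF assms(1) this(3), of True] lin_pos[OF assms(1) this(4), of False] this
  have 1: "lin w True ?x \<le> 13/10 * lin w True ?x'"
    using digit_hi_bounds(2)[where s = "st w" and d = k] n k pos by (intro lin_scale[OF assms(1)]) (auto simp: field_simps)
  have 2: "lin w False ?y \<le> 15/10 * lin w False ?y'"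
    using digit_lo_bounds(2)[where s = "st w" and d = "k+1"] n k pos by (intro lin_scale[OF assms(1)]) (auto simp: field_simps)
  have "lin w True ?x * lin w False ?y \<le> (13/10 * lin w True ?x') * (15/10 * lin w False ?y')"
    using 1 2 pos by (intro mult_mono) auto
  then have "gap w ?x' ?y' \<le> (12/100) / (lin w True ?x * lin w False ?y / (195/100))"
    unfolding gap_def using n pos by (intro frac_le) auto
  also have "\<dots> = (234/1000) / (lin w True ?x * lin w False ?y)" by simp
  also have "\<dots> \<le> gap w ?x ?y" unfolding gap_def using g pos by (intro divide_right_mono) auto
  finally show ?thesis .
qed

text \<open>Here the child's gap is shorter and also lies at larger tails, so numerator and
  denominators both help.\<close>

lemma gap_outer_child:
  assumes "good w" "1 \<le> k" "k < max_digit (st w)"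
  shows "gap w (of_int (k + 1) + 1 / digit_lo s 2) (of_int (k + 1) + 1 / digit_hi s 1)
       \<le> gap w (digit_hi (st w) k) (digit_lo (st w) (k + 1))"
proof -
  let ?x' = "of_int (k + 1) + 1 / digit_lo s 2" and ?y' = "of_int (k + 1) + 1 / digit_hi s 1"
  let ?x = "digit_hi (st w) k" and ?y = "digit_lo (st w) (k + 1)"
  note n = child_gap_numeric[where j = "k + 1" and s = s]
  have k: "1 \<le> (of_int k :: real)" using assms by linarith
  have g: "3785/10000 \<le> ?y - ?x" using digit_gap_bounds[of "st w" k] by simp
  have le: "?x \<le> ?x'" "?y \<le> ?y'"
    using digit_hi_bounds(2)[where s = "st w" and d = k] digit_lo_bounds(2)[where s = "st w" and d = "k+1"] n by auto
  have "0 < ?x" "0 < ?y" using digit_hi_bounds[where s = "st w" and d = k] digit_lo_bounds[where s = "st w" and d = "k+1"] k by auto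
  note pos = lin_pos[OF assms(1) this(1), of True] lin_pos[OF assms(1) this(2), of False] this
  have "lin w True ?x * lin w False ?y \<le> lin w True ?x' * lin w False ?y'"
    using lin_mono[OF assms(1)] le pos by (intro mult_mono) (auto intro!: less_imp_le lin_pos[OF assms(1)])
  then show ?thesis
    unfolding gap_def using n g pos by (intro frac_le) auto
qed

section \<open>The interval tree and the product set\<close>

text \<open>The node \<open>(w, k)\<close> stands for the continuations of \<open>w\<close> with next digit at least \<open>k\<close>.
  Inner and outer refer to the order of the tails, which words of odd length reverse.\<close>

type_synonym node = "int list \<times> int"

definition nodes :: "node set" where
  "nodes = {(w, k). good w \<and> 1 \<le> k \<and> k < max_digit (st w)}"

fun inner :: "node \<Rightarrow> node" where
  "inner (w, k) = (k # w, 1)"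

text \<open>When only the digit \<open>k + 1\<close> remains there is no gap left at this level, so
  the node passes directly into the cylinder of that digit.\<close>

fun outer :: "node \<Rightarrow> node" where
  "outer (w, k) = (if k + 1 < max_digit (st w) then (w, k + 1) else ((k + 1) # w, 1))"

fun hull_inner :: "node \<Rightarrow> real" where
  "hull_inner (w, k) = digit_lo (st w) k"

fun hull_outer :: "node \<Rightarrow> real" where
  "hull_outer (w, k) = hi (st w)"

fun gap_inner :: "node \<Rightarrow> real" where
  "gap_inner (w, k) = digit_hi (st w) k"

fun gap_outer :: "node \<Rightarrow> real" where
  "gap_outer (w, k) = digit_lo (st w) (k + 1)"

definition flip :: "node \<Rightarrow> (node \<Rightarrow> 'a) \<Rightarrow> (node \<Rightarrow> 'a) \<Rightarrow> 'a" where
  "flip v f g = (if even (length (fst v)) then f v else g v)"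

definition node_l where "node_l v = cfw (fst v) (flip v hull_inner hull_outer)"
definition node_u where "node_u v = cfw (fst v) (flip v hull_outer hull_inner)"
definition node_g1 where "node_g1 v = cfw (fst v) (flip v gap_inner gap_outer)"
definition node_g2 where "node_g2 v = cfw (fst v) (flip v gap_outer gap_inner)"
definition node_lc where "node_lc v = flip v inner outer"
definition node_rc where "node_rc v = flip v outer inner"

text \<open>On nodes \<open>k\<close> is at most 3, so the weight 4 makes a longer word count more
  even though \<open>k\<close> is reset to 1.\<close>

fun node_m :: "node \<Rightarrow> nat" where
  "node_m (w, k) = 4 * length w + nat k"

lemmas node_defs = node_l_def node_u_def node_g1_def node_g2_def node_lc_def node_rc_def flip_def

lemma node_ends_ordered:
  assumes "v \<in> nodes"
  shows "1 \<le> hull_inner v" "hull_inner v \<le> gap_inner v" "gap_inner v \<le> gap_outer v"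
    "gap_outer v \<le> hull_outer v" "hull_outer v \<le> 5"
proof -
  obtain w k where v: "v = (w, k)" by (cases v)
  have k: "1 \<le> k" "k < max_digit (st w)" using assms v by (auto simp: nodes_def)
  then have "1 \<le> (of_int k :: real)" "of_int k + 1 \<le> (of_int (max_digit (st w)) :: real)" by linarith+
  then show "1 \<le> hull_inner v" "hull_inner v \<le> gap_inner v" "gap_inner v \<le> gap_outer v"
    "gap_outer v \<le> hull_outer v" "hull_outer v \<le> 5"
    using v digit_lo_bounds[where s = "st w" and d = k] digit_hi_bounds[where s = "st w" and d = k]
      digit_lo_bounds[where s = "st w" and d = "k + 1"] hi_bounds[of "st w"]
      digit_hi_bounds[where s = "st w" and d = "max_digit (st w)"]
    by (auto simp: digit_hi_max)
qed

definition node_gap :: "node \<Rightarrow> real" where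
  "node_gap v = gap (fst v) (gap_inner v) (gap_outer v)"

lemma node_good: "v \<in> nodes \<Longrightarrow> good (fst v)"
  by (auto simp: nodes_def)

lemma node_gap_ratio: "v \<in> nodes \<Longrightarrow> node_g2 v / node_g1 v = 1 + node_gap v"
  using mob_ratio[OF node_good, of v "gap_inner v" "gap_outer v"] node_ends_ordered[of v]
  by (auto simp: node_defs cfw_def node_gap_def)

lemma max_digit_ge: "3 \<le> max_digit s"
  by (simp add: max_digit_def)

lemma inner_in_nodes:
  assumes "v \<in> nodes"
  shows "inner v \<in> nodes"
proof -
  obtain w k where v: "v = (w, k)" by (cases v)
  then show ?thesis
    using assms max_digit_ge[of "st (k # w)"] good.Cons[of w k] by (auto simp: nodes_def)
qed

lemma outer_in_nodes:
  assumes "v \<in> nodes"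
  shows "outer v \<in> nodes"
proof -
  obtain w k where v: "v = (w, k)" by (cases v)
  then show ?thesis
    using assms max_digit_ge[of "st ((k + 1) # w)"] good.Cons[of w "k + 1"] by (auto simp: nodes_def)
qed

lemma cfw_digit_lo: "cfw w (digit_lo (st w) d) = cfw (d # w) (hi (st (d # w)))"
  using hi_bounds(1)[of "nxt (st w) d"] by (simp add: cfw_Cons digit_lo_def)

lemma cfw_digit_hi: "cfw w (digit_hi (st w) d) = cfw (d # w) (digit_lo (st (d # w)) 1)"
  using lo_bounds(1)[of "nxt (st w) d"] by (simp add: cfw_Cons digit_hi_def digit_lo_1)

lemma cfw_hi: "cfw w (hi (st w)) = cfw (max_digit (st w) # w) (digit_lo (st (max_digit (st w) # w)) 1)"
  using cfw_digit_hi[of w "max_digit (st w)"] by (simp add: digit_hi_max)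

lemma node_child_ends:
  assumes "v \<in> nodes"
  shows "node_l (node_lc v) = node_l v" "node_u (node_lc v) = node_g1 v"
    "node_l (node_rc v) = node_g2 v" "node_u (node_rc v) = node_u v"
proof -
  obtain w k where v: "v = (w, k)" by (cases v)
  have "max_digit (st w) = k + 1" if "\<not> k + 1 < max_digit (st w)"
    using assms v that by (auto simp: nodes_def)
  then show "node_l (node_lc v) = node_l v" "node_u (node_lc v) = node_g1 v"
    "node_l (node_rc v) = node_g2 v" "node_u (node_rc v) = node_u v"
    using v cfw_hi[of w]
    by (auto simp: node_defs cfw_digit_lo cfw_digit_hi simp del: st_Cons)
qed

lemma node_gap_le_bridges:
  assumes "v \<in> nodes"
  shows "node_gap v \<le> gap (fst v) (hull_inner v) (gap_inner v)"
    "node_gap v \<le> gap (fst v) (gap_outer v) (hull_outer v)"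
proof -
  obtain w k where v: "v = (w, k)" by (cases v)
  have g: "good w" and k: "1 \<le> k" "k < max_digit (st w)" using assms v by (auto simp: nodes_def)
  show "node_gap v \<le> gap (fst v) (hull_inner v) (gap_inner v)"
    unfolding node_gap_def using node_ends_ordered[OF assms] v
      digit_gap_bounds(2)[of "st w" k] digit_lo_bounds[where s = "st w" and d = k]
      digit_hi_bounds[where s = "st w" and d = k]
    by (intro gap_le_inner[OF node_good[OF assms]]) auto
  show "node_gap v \<le> gap (fst v) (gap_outer v) (hull_outer v)"
    unfolding node_gap_def using node_ends_ordered[OF assms] v outer_bridge_numeric[OF k]
    by (intro gap_le_outer[OF node_good[OF assms] refl]) auto
qed

text \<open>The last digit reverses the order of the tails and also inverts \<open>mob\<close>; the
  two effects cancel in the ratio.\<close>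

lemma node_gap_single:
  assumes "good w" "good (d # w)" "0 \<le> d"
  shows "node_gap (d # w, 1) = gap w (of_int d + 1 / digit_lo (st (d # w)) 2) (of_int d + 1 / digit_hi (st (d # w)) 1)"
proof -
  let ?s = "st (d # w)"
  let ?x = "digit_hi ?s 1" and ?y = "digit_lo ?s 2"
  have pos: "0 < ?x" "0 < ?y"
    using digit_hi_bounds(1)[where s = ?s and d = 1] digit_lo_bounds(1)[where s = ?s and d = 2] by auto
  then have pos': "0 < of_int d + 1 / ?x" "0 < of_int d + 1 / ?y"
    using assms(3) by (auto intro: add_nonneg_pos)
  have "1 + gap (d # w) ?x ?y = mob (d # w) ?y / mob (d # w) ?x"
    using mob_ratio[OF assms(2) pos] by simp
  also have "\<dots> = mob w (of_int d + 1 / ?x) / mob w (of_int d + 1 / ?y)"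
    using mob_Cons[of ?x d w] mob_Cons[of ?y d w] pos by simp
  also have "\<dots> = 1 + gap w (of_int d + 1 / ?y) (of_int d + 1 / ?x)"
    using mob_ratio[OF assms(1) pos'(2,1)] .
  finally show ?thesis by (simp add: node_gap_def)
qed

lemma node_gap_children:
  assumes "v \<in> nodes"
  shows "node_gap (inner v) \<le> node_gap v" "node_gap (outer v) \<le> node_gap v"
proof -
  obtain w k where v: "v = (w, k)" by (cases v)
  have g: "good w" and k: "1 \<le> k" "k < max_digit (st w)" using assms v by (auto simp: nodes_def)
  show "node_gap (inner v) \<le> node_gap v"
    using node_gap_single[OF g, of k] node_good[OF inner_in_nodes[OF assms]] v k gap_inner_child[OF g k]
    by (simp add: node_gap_def)
  show "node_gap (outer v) \<le> node_gap v"
  proof (cases "k + 1 < max_digit (st w)")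
    case True
    then show ?thesis using v gap_next_digit[OF g k(1) True] by (simp add: node_gap_def add.commute)
  next
    case False
    then show ?thesis
      using node_gap_single[OF g, of "k + 1"] node_good[OF outer_in_nodes[OF assms]] v k gap_outer_child[OF g k]
      by (simp add: node_gap_def)
  qed
qed

section \<open>Bounds for relative gaps in terms of word length\<close>

lemma node_gap_lower:
  assumes "v \<in> nodes" "length (fst v) \<le> N"
  shows "(3785/10000) / (36 * 5 ^ N * 5 ^ N) \<le> node_gap v"
proof -
  obtain w k where v: "v = (w, k)" by (cases v)
  have g: "good w" using assms v by (auto simp: nodes_def)
  have pow: "(5::real) ^ length w \<le> 5 ^ N" using assms(2) v by (simp add: power_increasing)
  have lin: "0 < lin w b t \<and> lin w b t \<le> 6 * 5 ^ N" if "1 \<le> t" "t \<le> 5" for b t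
  proof -
    have "fst (coef w b) * t \<le> fst (coef w b) * 5"
      using that good_coef(3)[OF g, of b] by (intro mult_left_mono) auto
    then show ?thesis
      using good_coef(2,3,5)[OF g, of b] pow lin_pos[OF g, of t b] that unfolding lin_def by linarith
  qed
  note e = node_ends_ordered[OF assms(1)]
  let ?P = "lin w True (gap_inner v)" and ?Q = "lin w False (gap_outer v)"
  have P: "0 < ?P" "?P \<le> 6 * 5 ^ N" using lin[of "gap_inner v" True] e by auto
  have Q: "0 < ?Q" "?Q \<le> 6 * 5 ^ N" using lin[of "gap_outer v" False] e by auto
  have "?P * ?Q \<le> (6 * 5 ^ N) * (6 * 5 ^ N)" using P Q by (intro mult_mono) auto
  then have "(3785/10000) / (36 * 5 ^ N * 5 ^ N) \<le> (gap_outer v - gap_inner v) / (?P * ?Q)"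
    using P Q digit_gap_bounds(1)[of "st w" k] v by (intro frac_le) auto
  then show ?thesis using v by (simp add: node_gap_def gap_def)
qed

lemma lin_lower:
  assumes "good w" "1 \<le> t"
  shows "(6/5) ^ length w \<le> lin w b t"
  using good_coef(1,3,6)[OF assms(1), of b] mult_left_mono[OF assms(2), of "fst (coef w b)"]
  unfolding lin_def by linarith

lemma gap_upper_bound:
  assumes "good w" "1 \<le> s" "s \<le> 5" "1 \<le> t" "t \<le> 5"
  shows "gap w s t \<le> 4 * (5/6) ^ length w"
proof -
  define P where "P = lin w True s"
  define Q where "Q = lin w False t"
  have 1: "1 \<le> (6/5 :: real) ^ length w" by simp
  have "(6/5) ^ length w \<le> P" "(6/5) ^ length w \<le> Q"
    using lin_lower assms by (auto simp: P_def Q_def)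
  with 1 have "1 \<le> Q" "0 \<le> P" "(6/5) ^ length w \<le> P" by linarith+
  then have "(6/5) ^ length w * 1 \<le> P * Q" by (intro mult_mono) auto
  then have PQ: "(6/5) ^ length w \<le> P * Q" "0 < P * Q" using 1 by linarith+
  have "gap w s t \<le> 4 / (P * Q)"
    unfolding gap_def P_def[symmetric] Q_def[symmetric] using assms PQ by (intro divide_right_mono) auto
  also have "\<dots> \<le> 4 / (6/5) ^ length w" using PQ by (intro divide_left_mono) auto
  also have "\<dots> = 4 * (5/6) ^ length w" by (simp add: power_divide)
  finally show ?thesis .
qed

lemma cfw_ratio_le:
  assumes "good w" "1 \<le> s" "s \<le> 5" "1 \<le> t" "t \<le> 5"
  shows "cfw w s \<le> (1 + 4 * (5/6) ^ length w) * cfw w t"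
proof -
  have m: "0 < mob w s" "0 < mob w t" using mob_pos[OF assms(1)] assms by auto
  have "mob w s / mob w t \<le> 1 + 4 * (5/6) ^ length w" "mob w t / mob w s \<le> 1 + 4 * (5/6) ^ length w"
    using mob_ratio[OF assms(1), of t s] mob_ratio[OF assms(1), of s t] assms
      gap_upper_bound[OF assms(1), of s t] gap_upper_bound[OF assms(1), of t s] by auto
  then show ?thesis using m by (auto simp: cfw_def field_simps)
qed

lemma node_length_le:
  assumes "v \<in> nodes"
  shows "node_m v \<le> 4 * length (fst v) + 3"
proof -
  obtain w k where "v = (w, k)" by (cases v)
  then show ?thesis using assms max_digit_le[of "st w"] by (auto simp: nodes_def)
qed

lemma node_m_children:
  assumes "v \<in> nodes"
  shows "node_m v < node_m (inner v)" "node_m v < node_m (outer v)"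
proof -
  obtain w k where "v = (w, k)" by (cases v)
  then show "node_m v < node_m (inner v)" "node_m v < node_m (outer v)"
    using assms max_digit_le[of "st w"] by (auto simp: nodes_def)
qed

interpretation hull_tree: ratio_tree nodes node_l node_g1 node_g2 node_u node_lc node_rc node_m
proof
  fix v assume v: "v \<in> nodes"
  note g = node_good[OF v] and e = node_ends_ordered[OF v]
  show "node_lc v \<in> nodes" "node_rc v \<in> nodes"
    using inner_in_nodes[OF v] outer_in_nodes[OF v] by (auto simp: node_defs)
  show "0 < node_l v" using mob_pos[OF g] e by (auto simp: node_defs cfw_def)
  show "node_l v \<le> node_g1 v" "node_g1 v \<le> node_g2 v" "node_g2 v \<le> node_u v"
    using mob_mono[OF g] mob_pos[OF g] e by (auto simp: node_defs cfw_def intro!: frac_le)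
  show "node_l (node_lc v) = node_l v" "node_u (node_lc v) = node_g1 v"
    "node_l (node_rc v) = node_g2 v" "node_u (node_rc v) = node_u v"
    using node_child_ends[OF v] by auto
  have r: "mob (fst v) (gap_inner v) / mob (fst v) (hull_inner v) = 1 + gap (fst v) (hull_inner v) (gap_inner v)"
    "mob (fst v) (hull_outer v) / mob (fst v) (gap_outer v) = 1 + gap (fst v) (gap_outer v) (hull_outer v)"
    using mob_ratio[OF g] e by auto
  show "node_g2 v / node_g1 v \<le> node_g1 v / node_l v"
    unfolding node_gap_ratio[OF v] using r node_gap_le_bridges[OF v] by (auto simp: node_defs cfw_def)
  show "node_g2 v / node_g1 v \<le> node_u v / node_g2 v"
    unfolding node_gap_ratio[OF v] using r node_gap_le_bridges[OF v] by (auto simp: node_defs cfw_def)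
  have i: "inner v \<in> nodes" "outer v \<in> nodes" using inner_in_nodes[OF v] outer_in_nodes[OF v] by auto
  show "node_g2 (node_lc v) / node_g1 (node_lc v) \<le> node_g2 v / node_g1 v"
    "node_g2 (node_rc v) / node_g1 (node_rc v) \<le> node_g2 v / node_g1 v"
    using node_gap_children[OF v] i by (auto simp: node_lc_def node_rc_def flip_def node_gap_ratio v)
  show "node_m v < node_m (node_lc v)" "node_m v < node_m (node_rc v)"
    using node_m_children[OF v] by (auto simp: node_lc_def node_rc_def flip_def)
next
  fix N
  show "\<exists>e>1. \<forall>v\<in>nodes. node_m v \<le> N \<longrightarrow> e \<le> node_g2 v / node_g1 v"
  proof (intro exI[of _ "1 + (3785/10000) / (36 * 5 ^ N * 5 ^ N)"] conjI ballI impI)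
    fix v assume v: "v \<in> nodes" "node_m v \<le> N"
    then have "length (fst v) \<le> N" by (cases v) simp
    then show "1 + (3785/10000) / (36 * 5 ^ N * 5 ^ N) \<le> node_g2 v / node_g1 v"
      using node_gap_lower[OF v(1)] node_gap_ratio[OF v(1)] by simp
  qed simp
next
  fix e :: real assume "e > 1"
  have "(\<lambda>n. 4 * (5/6::real) ^ n) \<longlonglongrightarrow> 4 * 0"
    by (intro tendsto_intros LIMSEQ_power_zero) simp
  from order_tendstoD(2)[OF this, of "e - 1"] \<open>e > 1\<close>
  obtain K where K: "\<And>n. n \<ge> K \<Longrightarrow> 4 * (5/6::real) ^ n < e - 1" by (auto simp: eventually_sequentially)
  show "\<exists>M. \<forall>v\<in>nodes. M \<le> node_m v \<longrightarrow> node_g2 v / node_g1 v < e"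
  proof (intro exI[of _ "4 * K + 3"] ballI impI)
    fix v assume v: "v \<in> nodes" "4 * K + 3 \<le> node_m v"
    then have "K \<le> length (fst v)" using node_length_le[OF v(1)] by linarith
    from K[OF this] show "node_g2 v / node_g1 v < e"
      using gap_upper_bound[OF node_good[OF v(1)], of "gap_inner v" "gap_outer v"]
        node_ends_ordered[OF v(1)] node_gap_ratio[OF v(1)] by (simp add: node_gap_def)
  qed
qed

section \<open>From infinite branches to elements of \<open>F4_star\<close>\<close>

definition prefix_word :: "(nat \<Rightarrow> int) \<Rightarrow> nat \<Rightarrow> int list" where
  "prefix_word a n = rev (map a [0..<n])"

lemma prefix_word_simps [simp]: "prefix_word a 0 = []" "prefix_word a (Suc n) = a n # prefix_word a n"
  by (simp_all add: prefix_word_def)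

lemma length_prefix_word [simp]: "length (prefix_word a n) = n"
  by (simp add: prefix_word_def)

lemma st_prefix_word: "st (prefix_word a n) = run S0 a n"
  by (induction n) (simp_all add: st_def)

lemma cfval_prefix_word:
  "digit_seq a \<Longrightarrow> cfval a = cfw (prefix_word a n) (cfval (\<lambda>i. a (i + n)))"
proof (induction n)
  case 0
  then show ?case by (simp add: cfw_Nil)
next
  case (Suc n)
  let ?b = "\<lambda>i. a (i + n)"
  have b: "digit_seq ?b" "digit_seq (\<lambda>i. a (i + Suc n))" using Suc.prems by (auto simp: digit_seq_def)
  have "cfval ?b = of_int (a n) + 1 / cfval (\<lambda>i. a (i + Suc n))" using cfval_shift[OF b(1)] by simp
  moreover have "cfval (\<lambda>i. a (i + Suc n)) \<noteq> 0" using cfval_bounds(1)[OF b(2)] by auto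
  ultimately show ?case using Suc by (simp add: cfw_Cons)
qed

lemma good_prefix_word:
  "good (prefix_word a n) \<Longrightarrow> 2 \<le> n \<and> a 0 = 4 \<and> a 1 = 3 \<and> (\<forall>i<n. 1 \<le> a i \<and> a i \<le> max_digit (run S0 a i))"
proof (induction n)
  case 0
  then show ?case by (auto elim: good.cases)
next
  case (Suc n)
  from Suc.prems have "a n # prefix_word a n = [3, 4] \<or> (good (prefix_word a n) \<and> 1 \<le> a n \<and> a n \<le> max_digit (st (prefix_word a n)))"
    by (auto elim: good.cases)
  then show ?case
  proof
    assume *: "a n # prefix_word a n = [3, 4]"
    then have "length (prefix_word a n) = 1" by simp
    then have "n = 1" by simp
    with * show ?thesis by (auto simp: less_Suc_eq max_digit_def nxt_def)
  next
    assume "good (prefix_word a n) \<and> 1 \<le> a n \<and> a n \<le> max_digit (st (prefix_word a n))"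
    then show ?thesis using Suc.IH by (auto simp: less_Suc_eq st_prefix_word)
  qed
qed

lemma desc_extends: "hull_tree.desc v v' \<Longrightarrow> \<exists>zs. fst v' = zs @ fst v"
  unfolding hull_tree.desc_def
proof (induction rule: rtranclp_induct)
  case (step y z)
  then obtain zs where "fst y = zs @ fst v" by blast
  moreover have "\<exists>zs. fst z = zs @ fst y"
    using step(2) by (cases y) (auto simp: node_lc_def node_rc_def flip_def split: if_splits)
  ultimately show ?case by auto
qed simp

lemma branch_limit:
  assumes nodes: "\<And>n. f n \<in> nodes" and desc: "\<And>n. hull_tree.desc (f n) (f (Suc n))"
    and m: "\<And>n. n \<le> node_m (f n)"
  obtains a where "admissible S0 a" "a 0 = 4" "a 1 = 3"
    "\<And>n. fst (f n) = prefix_word a (length (fst (f n)))"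
proof -
  define r where "r n = rev (fst (f n))" for n
  \<comment> \<open>By \<open>node_length_le\<close>, depth \<open>4 * i + 8\<close> guarantees a
    word of length at least \<open>i + 2\<close>, so position \<open>i\<close> is present.\<close>
  define a where "a i = r (4 * i + 8) ! i" for i
  have len: "i < length (r (4 * i + 8))" for i
    using node_length_le[OF nodes, of "4 * i + 8"] m[of "4 * i + 8"] by (simp add: r_def)
  have step: "\<exists>ys. r (Suc n) = r n @ ys" for n
    using desc_extends[OF desc[of n]] by (auto simp: r_def)
  have ext: "\<exists>ys. r j = r i @ ys" if "i \<le> j" for i j
    using that
  proof (induction rule: dec_induct)
    case (step k)
    then show ?case using \<open>\<And>n. \<exists>ys. r (Suc n) = r n @ ys\<close>[of k] by auto
  qed simp
  have agree: "r i ! k = r j ! k" if "k < length (r i)" "k < length (r j)" for i j k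
    using ext[of i j] ext[of j i] that by (cases "i \<le> j") (auto simp: nth_append)
  have "r n = map a [0..<length (r n)]" for n
    by (rule nth_equalityI) (auto simp: a_def intro: agree len)
  then have word: "fst (f n) = prefix_word a (length (fst (f n)))" for n
    unfolding prefix_word_def r_def by (metis length_rev rev_rev_ident)
  then have good: "good (prefix_word a (length (fst (f n))))" for n
    using node_good[OF nodes] by metis
  have "admissible S0 a"
    unfolding admissible_def
  proof
    fix i
    have "i < length (fst (f (4 * i + 8)))" using len[of i] by (simp add: r_def)
    then show "1 \<le> a i \<and> a i \<le> max_digit (run S0 a i)" using good_prefix_word[OF good] by blast
  qed
  then show ?thesis using that word good_prefix_word[OF good[of 0]] by blast
qed

lemma F4_star_eq: "F4_star = cfval ` {a. admissible S0 a \<and> a 0 = 4 \<and> a 1 = 3}"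
proof (intro equalityI subsetI)
  fix x assume "x \<in> F4_star"
  then obtain a where a: "has_cfrac x a" "(a 0, a 1) = (4, 3)" "admissible S0 a"
    unfolding F4_star_def mem_Collect_eq admissible_S0_iff[symmetric] by (elim conjE exE)
  have "x = cfval a" using has_cfrac_iff[OF admissible_digit_seq[OF a(3)]] a(1) by simp
  then show "x \<in> cfval ` {a. admissible S0 a \<and> a 0 = 4 \<and> a 1 = 3}" using a(2,3) by simp
next
  fix x assume "x \<in> cfval ` {a. admissible S0 a \<and> a 0 = 4 \<and> a 1 = 3}"
  then obtain a where a: "x = cfval a" "(a 0, a 1) = (4, 3)" "admissible S0 a" by auto
  note d = admissible_digit_seq[OF a(3)]
  have "x \<notin> \<rat>" "has_cfrac x a" using cfval_irrational[OF d] has_cfrac_iff[OF d] a(1) by simp_all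
  then show "x \<in> F4_star"
    unfolding F4_star_def mem_Collect_eq admissible_S0_iff[symmetric] using a(2,3) by (intro conjI exI)
qed

lemma F4_star_bounds:
  assumes "x \<in> F4_star"
  shows "cfw [3, 4] (lo S0) \<le> x" "x \<le> cfw [3, 4] (hi S0)"
proof -
  obtain a where a: "x = cfval a" "admissible S0 a" "a 0 = 4" "a 1 = 3"
    using assms by (auto simp: F4_star_eq)
  let ?t = "cfval (\<lambda>i. a (i + 2))"
  have w: "prefix_word a 2 = [3, 4]" using a by (simp add: numeral_2_eq_2)
  have "x = cfw [3, 4] ?t"
    using cfval_prefix_word[OF admissible_digit_seq[OF a(2)], of 2] a(1) w by simp
  moreover have "run S0 a 2 = S0" using st_prefix_word[of a 2] w st_43 by simp
  then have "lo S0 \<le> ?t" "?t \<le> hi S0" using cfval_hull[OF admissible_shiftn[OF a(2), of 2]] by auto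
  ultimately show "cfw [3, 4] (lo S0) \<le> x" "x \<le> cfw [3, 4] (hi S0)"
    using mob_mono[OF good.start] lo_bounds(1)[of S0] by (auto simp: cfw_def)
qed

text \<open>The limit and both interval ends are images of tails in [1, 5] under one word, so any
  two of them differ by a factor of at most \<open>1 + 4 * (5/6) ^ i\<close>.\<close>

lemma F4_star_branch:
  assumes nodes: "\<And>n. f n \<in> nodes" and desc: "\<And>n. hull_tree.desc (f n) (f (Suc n))"
    and m: "\<And>n. n \<le> node_m (f n)"
  obtains x where "x \<in> F4_star" "0 < x"
    "\<And>i. x \<le> (1 + 4 * (5/6) ^ i) * node_l (f (4 * i + 8))"
    "\<And>i. node_u (f (4 * i + 8)) \<le> (1 + 4 * (5/6) ^ i) * x"
proof -
  obtain a where a: "admissible S0 a" "a 0 = 4" "a 1 = 3"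
    and word: "\<And>n. fst (f n) = prefix_word a (length (fst (f n)))"
    using branch_limit[OF nodes desc m] by blast
  note d = admissible_digit_seq[OF a(1)]
  have pos: "0 < cfval a" using cfval_bounds(1)[OF d] by simp
  have main: "cfval a \<le> (1 + 4 * (5/6) ^ i) * node_l (f (4 * i + 8)) \<and>
      node_u (f (4 * i + 8)) \<le> (1 + 4 * (5/6) ^ i) * cfval a" for i
  proof -
    let ?v = "f (4 * i + 8)"
    let ?w = "fst ?v"
    let ?t = "cfval (\<lambda>j. a (j + length ?w))"
    have v: "?v \<in> nodes" using nodes .
    have i: "i \<le> length ?w" using node_length_le[OF v] m[of "4 * i + 8"] by linarith
    have "digit_seq (\<lambda>j. a (j + length ?w))" using d by (simp add: digit_seq_def)
    then have t: "1 \<le> ?t" "?t \<le> 5" using cfval_bounds by fastforce+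
    have x: "cfval a = cfw ?w ?t" using cfval_prefix_word[OF d] word by metis
    have e: "(5/6::real) ^ length ?w \<le> (5/6) ^ i" using i by (intro power_decreasing) auto
    have le: "cfw ?w s \<le> (1 + 4 * (5/6) ^ i) * cfw ?w s'"
      if "1 \<le> s" "s \<le> 5" "1 \<le> s'" "s' \<le> 5" for s s'
    proof -
      have "0 < cfw ?w s'" using mob_pos[OF node_good[OF v]] that by (simp add: cfw_def)
      then have "(1 + 4 * (5/6) ^ length ?w) * cfw ?w s' \<le> (1 + 4 * (5/6) ^ i) * cfw ?w s'"
        using e by (intro mult_right_mono) auto
      then show ?thesis using cfw_ratio_le[OF node_good[OF v] that] by linarith
    qed
    show ?thesis
      using le t node_ends_ordered[OF v] unfolding x by (auto simp: node_l_def node_u_def flip_def)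
  qed
  show ?thesis using that[of "cfval a"] main pos a by (auto simp: F4_star_eq)
qed

text \<open>Along the two branches \<open>z\<close> stays between the products of the left ends and
  of the right ends, and \<open>x * y\<close> agrees with both up to the factor \<open>q i\<close>.
  As \<open>q\<close> tends to 1, \<open>x * y\<close> and \<open>z\<close> coincide.\<close>

lemma F4_star_product_full:
  assumes z: "z \<in> {(cfw [3, 4] (lo S0))\<^sup>2..(cfw [3, 4] (hi S0))\<^sup>2}"
  shows "\<exists>x y. z = x * y \<and> x \<in> F4_star \<and> y \<in> F4_star"
proof -
  let ?v = "([3, 4], 1) :: node"
  have v: "?v \<in> nodes" by (simp add: nodes_def good.start st_43 max_digit_def del: st_Cons)
  have ends: "node_l ?v = cfw [3, 4] (lo S0)" "node_u ?v = cfw [3, 4] (hi S0)"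
    by (simp_all add: node_defs st_43 digit_lo_1 del: st_Cons)
  have "node_g2 ?v / node_g1 ?v \<le> node_u ?v / node_g2 ?v" by (rule hull_tree.right_bridge[OF v])
  also have "\<dots> \<le> node_u ?v / node_l ?v"
    using hull_tree.ordered[OF v] hull_tree.pos[OF v] by (intro divide_left_mono) auto
  finally have "hull_tree.linked ?v ?v" using v by (simp add: hull_tree.linked_def)
  moreover have "z \<in> {node_l ?v * node_l ?v..node_u ?v * node_u ?v}"
    using z by (simp add: ends power2_eq_square)
  ultimately obtain f g where f: "\<And>n. f n \<in> nodes" "\<And>n. hull_tree.desc (f n) (f (Suc n))" "\<And>n. n \<le> node_m (f n)"
    and g: "\<And>n. g n \<in> nodes" "\<And>n. hull_tree.desc (g n) (g (Suc n))" "\<And>n. n \<le> node_m (g n)"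
    and zn: "\<And>n. z \<in> {node_l (f n) * node_l (g n)..node_u (f n) * node_u (g n)}"
    by (rule hull_tree.linked_branches) blast
  obtain x where x: "x \<in> F4_star" "0 < x"
    "\<And>i. x \<le> (1 + 4 * (5/6) ^ i) * node_l (f (4 * i + 8))"
    "\<And>i. node_u (f (4 * i + 8)) \<le> (1 + 4 * (5/6) ^ i) * x"
    using F4_star_branch[OF f] by blast
  obtain y where y: "y \<in> F4_star" "0 < y"
    "\<And>i. y \<le> (1 + 4 * (5/6) ^ i) * node_l (g (4 * i + 8))"
    "\<And>i. node_u (g (4 * i + 8)) \<le> (1 + 4 * (5/6) ^ i) * y"
    using F4_star_branch[OF g] by blast
  define q :: "nat \<Rightarrow> real" where "q i = (1 + 4 * (5/6) ^ i) * (1 + 4 * (5/6) ^ i)" for i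
  have q0: "0 \<le> 1 + 4 * (5/6 :: real) ^ i" for i by (simp add: add_nonneg_nonneg)
  have pf: "0 < node_l (f n)" "0 < node_u (f n)" "0 < node_l (g n)" "0 < node_u (g n)" for n
    using hull_tree.pos[OF f(1)] hull_tree.pos[OF g(1)] hull_tree.ordered[OF f(1)] hull_tree.ordered[OF g(1)]
    by (meson less_le_trans order_trans)+
  have up: "x * y \<le> q i * z" for i
  proof -
    let ?n = "4 * i + 8"
    have "x * y \<le> ((1 + 4 * (5/6) ^ i) * node_l (f ?n)) * ((1 + 4 * (5/6) ^ i) * node_l (g ?n))"
      using x(2,3) y(2,3) q0 pf by (intro mult_mono mult_nonneg_nonneg) (auto intro: less_imp_le)
    also have "\<dots> = q i * (node_l (f ?n) * node_l (g ?n))" by (simp add: q_def)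
    also have "\<dots> \<le> q i * z" using zn[of ?n] q0 by (intro mult_left_mono) (auto simp: q_def)
    finally show ?thesis .
  qed
  have low: "z \<le> q i * (x * y)" for i
  proof -
    let ?n = "4 * i + 8"
    have "z \<le> node_u (f ?n) * node_u (g ?n)" using zn[of ?n] by simp
    also have "\<dots> \<le> ((1 + 4 * (5/6) ^ i) * x) * ((1 + 4 * (5/6) ^ i) * y)"
      using x(2,4) y(2,4) q0 pf by (intro mult_mono mult_nonneg_nonneg) (auto intro: less_imp_le)
    finally show ?thesis by (simp add: q_def mult_ac)
  qed
  have q: "q \<longlonglongrightarrow> (1 + 4 * 0) * (1 + 4 * 0)"
    unfolding q_def by (intro tendsto_intros LIMSEQ_power_zero) simp_all
  have "x * y \<le> z"
    using LIMSEQ_le_const[OF tendsto_mult[OF q tendsto_const], of "x * y" z] up by auto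
  moreover have "z \<le> x * y"
    using LIMSEQ_le_const[OF tendsto_mult[OF q tendsto_const], of z "x * y"] low by auto
  ultimately show ?thesis using x(1) y(1) by (intro exI[of _ x] exI[of _ y]) auto
qed

section \<open>Closed forms of the endpoints\<close>

lemma cfw_43: "cfw [3, 4] t = (13 * t + 4) / (3 * t + 1)"
  by (simp add: cfw_def mob_def lin_def)

lemma cfrac_endpoints:
  "cfrac (periodic_seq [4, 3] [1, 4, 1, 4, 1, 3]) = cfw [3, 4] (lo S0)"
  "cfrac (periodic_seq [4, 3] [4, 1, 4, 1, 3, 1]) = cfw [3, 4] (hi S0)"
proof -
  have "lo S0 \<noteq> 0" "hi S0 \<noteq> 0" using lo_bounds[of S0] hi_bounds[of S0] by auto
  then have c: "cfw [3, 4] (lo S0) = 4 + 1 / (3 + 1 / lo S0)" "cfw [3, 4] (hi S0) = 4 + 1 / (3 + 1 / hi S0)"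
    using lo_bounds(1)[of S0] hi_bounds(1)[of S0] by (simp_all add: cfw_43 divide_simps add_pos_pos)
  show "cfrac (periodic_seq [4, 3] [1, 4, 1, 4, 1, 3]) = cfw [3, 4] (lo S0)"
    by (simp add: c cfrac_eq_cfval digit_seq_periodic cfval_periodic_Cons cfval_periodic_lo)
  show "cfrac (periodic_seq [4, 3] [4, 1, 4, 1, 3, 1]) = cfw [3, 4] (hi S0)"
    by (simp add: c cfrac_eq_cfval digit_seq_periodic cfval_periodic_Cons cfval_periodic_hi)
qed

lemma cfw_43_lo: "(cfw [3, 4] (lo S0))\<^sup>2 = (106609 + 261 * sqrt 26565) / 8214"
proof -
  \<comment> \<open>The factor \<open>(783 + sqrt 26565) / 222\<close> comes from rationalising the
    denominator of \<open>cfw_43\<close> at \<open>lo S0\<close>.\<close>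
  have "13 * lo S0 + 4 = (783 + sqrt 26565) / 222 * (3 * lo S0 + 1)"
    using sqrt_26565_sq by (simp add: lo_def field_simps)
  then have eq: "cfw [3, 4] (lo S0) = (783 + sqrt 26565) / 222"
    using lo_bounds(1)[of S0] by (simp add: cfw_43 nonzero_divide_eq_eq)
  show ?thesis unfolding eq using sqrt_26565_sq by (simp add: power2_eq_square field_simps)
qed

lemma cfw_43_hi: "(cfw [3, 4] (hi S0))\<^sup>2 = (15143783 - 5501 * sqrt 26565) / 766322"
proof -
  have "13 * hi S0 + 4 = (5501 - sqrt 26565) / 1238 * (3 * hi S0 + 1)"
    using sqrt_26565_sq by (simp add: hi_def field_simps)
  then have eq: "cfw [3, 4] (hi S0) = (5501 - sqrt 26565) / 1238"
    using hi_bounds(1)[of S0] by (simp add: cfw_43 nonzero_divide_eq_eq)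
  show ?thesis unfolding eq using sqrt_26565_sq by (simp add: power2_eq_square field_simps)
qed

theorem mainTheorem4:
  shows "{x * y | x y. x \<in> F4_star \<and> y \<in> F4_star} =
           {(cfrac (periodic_seq [4, 3] [1, 4, 1, 4, 1, 3]))\<^sup>2 ..
            (cfrac (periodic_seq [4, 3] [4, 1, 4, 1, 3, 1]))\<^sup>2}
       \<and> (cfrac (periodic_seq [4, 3] [1, 4, 1, 4, 1, 3]))\<^sup>2 = (106609 + 261 * sqrt 26565) / 8214
       \<and> (cfrac (periodic_seq [4, 3] [4, 1, 4, 1, 3, 1]))\<^sup>2 = (15143783 - 5501 * sqrt 26565) / 766322"
proof -
  have p: "0 < cfw [3, 4] (lo S0)" using mob_pos[OF good.start, of "lo S0"] lo_bounds(1)[of S0] by (simp add: cfw_def)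
  have "x * y \<in> {(cfw [3, 4] (lo S0))\<^sup>2..(cfw [3, 4] (hi S0))\<^sup>2}" if "x \<in> F4_star" "y \<in> F4_star" for x y
    using F4_star_bounds[OF that(1)] F4_star_bounds[OF that(2)] p
    by (auto simp: power2_eq_square intro!: mult_mono)
  then have "{x * y | x y. x \<in> F4_star \<and> y \<in> F4_star} = {(cfw [3, 4] (lo S0))\<^sup>2..(cfw [3, 4] (hi S0))\<^sup>2}"
    using F4_star_product_full by blast
  then show ?thesis unfolding cfrac_endpoints using cfw_43_lo cfw_43_hi by blast
qed

end
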